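(* Let $\alpha_j>-1$, $\beta_j>0$ for $j=1,2$, let $$f_j(x)=\frac{\Gamma(\alpha_j+1+\beta_j)}{\Gamma(\alpha_j+1)\Gamma(\beta_j)}x^{\alpha_j}(1+x)^{-(\alpha_j+1+\beta_j)},\quad 0\le x<\infty,$$ and zero elsewhere, let $c=\prod_{j=1}^2\frac{\Gamma(\alpha_j+1+\beta_j)}{\Gamma(\alpha_j+1)\Gamma(\beta_j)}$, and let $g_1(u)=\int_0^\infty \frac1v f_1(\frac uv)f_2(v)\,dv$. Then for $0\le u<\infty$ $$g_1(u)=c\,u^{\alpha_1}\int_0^{\infty}v^{\beta_1+\alpha_2}(u+v)^{-(\alpha_1+1+\beta_1)}(1+v)^{-(\alpha_2+1+\beta_2)}\,dv$$ $$=c\,u^{\alpha_2}\int_0^{\infty}v^{\alpha_1+\beta_2}(1+v)^{-(\alpha_1+1+\beta_1)}(v+u)^{-(\alpha_2+1+\beta_2)}\,dv$$ $$=\left\{\prod_{j=1}^2\frac{1}{\Gamma(\alpha_j+1)\Gamma(\beta_j)}\right\}G^{2,2}_{2,2}\left[u\,\Big|\,{-\beta_1,-\beta_2\atop \alpha_1,\alpha_2}\right].$$ Moreover, if $0\le u<1$ and $\alpha_1-\alpha_2\ne\pm\nu$ for all $\nu=0,1,\dots$, then $$G^{2,2}_{2,2}\left[u\,\Big|\,{-\beta_1,-\beta_2\atop \alpha_1,\alpha_2}\right]=\Gamma(\alpha_2-\alpha_1)\Gamma(\beta_1+1+\alpha_1)\Gamma(\beta_2+1+\alpha_1)u^{\alpha_1}\,{}_2F_1(\beta_1+1+\alpha_1,\beta_2+1+\alpha_1;1+\alpha_1-\alpha_2;u)$$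 $$+\Gamma(\alpha_1-\alpha_2)\Gamma(\beta_1+1+\alpha_2)\Gamma(\beta_2+1+\alpha_2)u^{\alpha_2}\,{}_2F_1(\beta_1+1+\alpha_2,\beta_2+1+\alpha_2;1+\alpha_2-\alpha_1;u),$$ and if $1\le u<\infty$ and $\beta_1-\beta_2\ne\pm\nu$ for all $\nu=0,1,\dots$, then $$G^{2,2}_{2,2}\left[u\,\Big|\,{-\beta_1,-\beta_2\atop \alpha_1,\alpha_2}\right]=\Gamma(\alpha_1+1+\beta_1)\Gamma(\alpha_2+\beta_1+1)\Gamma(\beta_2-\beta_1)u^{-\beta_1-1}\,{}_2F_1(\alpha_1+\beta_1+1,\alpha_2+\beta_1+1;1+\beta_1-\beta_2;\tfrac1u)$$ $$+\Gamma(\alpha_1+\beta_2+1)\Gamma(\alpha_2+\beta_2+1)\Gamma(\beta_1-\beta_2)u^{-\beta_2-1}\,{}_2F_1(\alpha_1+\beta_2+1,\alpha_2+\beta_2+1;1+\beta_2-\beta_1;\tfrac1u).$$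
   Context: Meijer G-function: $$G^{m,n}_{p,q}\left[z\,\Big|\,{a_1,\dots,a_p\atop b_1,\dots,b_q}\right]=\frac1{2\pi i}\int_{\kappa-i\infty}^{\kappa+i\infty}\frac{\prod_{j=1}^m\Gamma(b_j+s)\prod_{j=1}^n\Gamma(1-a_j-s)}{\prod_{j=m+1}^q\Gamma(1-b_j-s)\prod_{j=n+1}^p\Gamma(a_j+s)}\,z^{-s}\,ds,$$ where the real number $\kappa$ is such that all poles of $\Gamma(b_j+s)$, $j\le m$, lie to the left and all poles of $\Gamma(1-a_j-s)$, $j\le n$, lie to the right of the line $\Re s=\kappa$. In the present case the integrand is $\Gamma(\alpha_1+s)\Gamma(\alpha_2+s)\Gamma(1+\beta_1-s)\Gamma(1+\beta_2-s)u^{-s}$. ${}_2F_1$ is the Gauss hypergeometric series. The function $g_1$ is the Mellin convolution of a product of $f_1$ and $f_2$ (the density of $u=x_1x_2$ for independent positive random variables $x_1,x_2$ with densities $f_1,f_2$).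
   Formalization: At u=1 the last formula is asserted only if both 2F1 series converge there (otherwise its right side is undefined), plus the limit of the right side as u→1+ being G(1); at u=0 powers of 0 are read as 0, since the expressions are undefined there when some α_j≤0. *)

theory Defs
  imports "HOL-Complex_Analysis.Complex_Analysis"
begin

(* Type-2 beta density.  Since "0 powr a = 0" for every a, the value at x = 0 is 0 for all \<alpha>,
   including \<alpha> \<le> 0, where x^\<alpha> is 1 or infinite at the origin. *)
definition type2_beta_density :: "real \<Rightarrow> real \<Rightarrow> real \<Rightarrow> real" where
  "type2_beta_density \<alpha> \<beta> x =
     (if 0 \<le> x
      then Gamma (\<alpha> + 1 + \<beta>) / (Gamma (\<alpha> + 1) * Gamma \<beta>) *
             x powr \<alpha> * (1 + x) powr (- (\<alpha> + 1 + \<beta>))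
      else 0)"

definition mellin_convolution :: "(real \<Rightarrow> real) \<Rightarrow> (real \<Rightarrow> real) \<Rightarrow> real \<Rightarrow> real" where
  "mellin_convolution f g u = (LBINT v:{0<..}. 1 / v * f (u / v) * g v)"

definition hyp2F1 :: "real \<Rightarrow> real \<Rightarrow> real \<Rightarrow> real \<Rightarrow> real" where
  "hyp2F1 a b c z = eval_fps (fps_hypergeo [a, b] [c] 1) z"

definition hyp2F1_converges :: "real \<Rightarrow> real \<Rightarrow> real \<Rightarrow> real \<Rightarrow> bool" where
  "hyp2F1_converges a b c z \<longleftrightarrow> summable (\<lambda>k. fps_hypergeo [a, b] [c] 1 $ k * z ^ k)"

(* The upper parameters a_1, ..., a_p and the lower parameters b_1, ..., b_q are given as lists,
   indexed from 0.  The library's Gamma is 0 at its poles and division by 0 gives 0, so a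
   quotient by Gamma vanishes at the poles of Gamma, as 1 / Gamma does. *)
definition meijer_G_integrand ::
  "nat \<Rightarrow> nat \<Rightarrow> complex list \<Rightarrow> complex list \<Rightarrow> complex \<Rightarrow> complex \<Rightarrow> complex" where
  "meijer_G_integrand m n as bs z s =
     ((\<Prod>j<m. Gamma (bs ! j + s)) * (\<Prod>j<n. Gamma (1 - as ! j - s))) /
     ((\<Prod>j\<in>{m..<length bs}. Gamma (1 - bs ! j - s)) * (\<Prod>j\<in>{n..<length as}. Gamma (as ! j + s)))
     * z powr (- s)"

definition meijer_G_separates ::
  "nat \<Rightarrow> nat \<Rightarrow> complex list \<Rightarrow> complex list \<Rightarrow> real \<Rightarrow> bool" where
  "meijer_G_separates m n as bs \<kappa> \<longleftrightarrow>
     (\<forall>j<m. \<forall>s. is_pole (\<lambda>s. Gamma (bs ! j + s)) s \<longrightarrow> Re s < \<kappa>) \<and>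
     (\<forall>j<n. \<forall>s. is_pole (\<lambda>s. Gamma (1 - as ! j - s)) s \<longrightarrow> \<kappa> < Re s)"

(* Improper integral along Re s = \<kappa>; the two ends tend to infinity independently. *)
definition vertical_line_integral :: "real \<Rightarrow> (complex \<Rightarrow> complex) \<Rightarrow> complex" where
  "vertical_line_integral \<kappa> F =
     Lim (at_top \<times>\<^sub>F at_top)
       (\<lambda>(S, T). contour_integral (linepath (Complex \<kappa> (- S)) (Complex \<kappa> T)) F)"

(* By Cauchy's theorem the value does not depend on the choice of the separating line. *)
definition meijer_G ::
  "nat \<Rightarrow> nat \<Rightarrow> complex list \<Rightarrow> complex list \<Rightarrow> complex \<Rightarrow> complex" where
  "meijer_G m n as bs z =
     1 / (2 * of_real pi * \<i>) *
       vertical_line_integral (SOME \<kappa>. meijer_G_separates m n as bs \<kappa>)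
         (meijer_G_integrand m n as bs z)"

end

theory Submission
  imports Defs "HOL-Probability.Characteristic_Functions" "HOL-Probability.Sinc_Integral"
    "HOL-Real_Asymp.Real_Asymp"
begin

text \<open>
  Write the integrand of the Meijer function on the line \<open>Re s = \<kappa>\<close> as \<open>s = \<kappa> + \<i> t\<close> and put
  \<open>a\<^sub>j = \<alpha>\<^sub>j + \<kappa>\<close>, \<open>b\<^sub>j = 1 + \<beta>\<^sub>j - \<kappa>\<close>. That \<open>\<kappa>\<close> separates the poles says exactly that these four
  numbers are positive, and the Meijer function becomes \<open>u powr (- \<kappa>) / (2 \<pi>)\<close> times the Fourier
  integral, at frequency \<open>ln u\<close>, of
  \<open>\<Gamma>(a\<^sub>1 + \<i> t) \<Gamma>(a\<^sub>2 + \<i> t) \<Gamma>(b\<^sub>1 - \<i> t) \<Gamma>(b\<^sub>2 - \<i> t)\<close>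
  (\<open>meijer_G_eq_barnes_integral\<close>).

  The integral representations are an instance of Mellin inversion. By the Beta integral,
  \<open>\<Gamma>(a + \<i> t) \<Gamma>(b - \<i> t)\<close> is the Fourier transform of \<open>\<Gamma>(a + b)\<close> times
  \<open>e\<^sup>a\<^sup>y (1 + e\<^sup>y) powr (- a - b)\<close>, the type-2 beta density in a logarithmic variable up to a
  constant (\<open>Gamma_product_eq_fourier\<close>). Hence the product of two such pairs is the transform of a
  convolution, and Fourier inversion (\<open>fourier_inversion\<close>) recovers that convolution
  (\<open>barnes_integral_eq_convolution\<close>); the substitution \<open>v = e\<^sup>y\<close> turns it into the integral over
  \<open>v\<close> (\<open>log_beta_kernel_convolution\<close>). The second real integral is the first one with the indices 1
  and 2 interchanged, and the Meijer function is symmetric in them.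

  The hypergeometric expansion for \<open>u < 1\<close> comes from moving the line of integration to the left past
  the poles \<open>- a\<^sub>j - k\<close> of \<open>\<Gamma>(a\<^sub>1 + s) \<Gamma>(a\<^sub>2 + s)\<close> (\<open>vertical_line_shift\<close>). These poles are simple
  because \<open>a\<^sub>1 - a\<^sub>2\<close> is not an integer, and their residues are the terms of the two hypergeometric
  series (\<open>residue_barnes\<close>). Asymptotics of the Gamma function are avoided when bounding the
  integral over the shifted line: the functional equation compares
  \<open>\<Gamma>(a + s - N) \<Gamma>(b - s + N)\<close> with \<open>\<Gamma>(a + s) \<Gamma>(b - s)\<close> factor by factor, and each of the \<open>N\<close> factors
  is at most a quantity tending to 1 (\<open>norm_Gamma_pair_shift_left\<close>), so that the factor \<open>u\<^sup>N\<close>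
  wins. The expansion for \<open>u > 1\<close> follows by \<open>t \<mapsto> - t\<close>, which exchanges the \<open>a\<^sub>j\<close> with the \<open>b\<^sub>j\<close> and
  replaces \<open>u\<close> by \<open>1 / u\<close>.

  At \<open>u = 1\<close> the Meijer function is continuous, by dominated convergence, which gives the one-sided
  limit; if both series converge at 1, an Abel-type argument (\<open>hyp2F1_tendsto_1\<close>) shows that the limit
  is their value there.
\<close>

section \<open>Products of Gamma functions as Fourier transforms\<close>

lemma lborel_integral_exp_substitution:
  fixes f :: "real \<Rightarrow> 'a::euclidean_space"
  assumes [measurable]: "f \<in> borel_measurable borel"
  shows "integrable lborel (\<lambda>y. exp y *\<^sub>R f (exp y)) \<longleftrightarrow> set_integrable lborel {0<..} f"
    and "(LBINT y. exp y *\<^sub>R f (exp y)) = (LBINT v:{0<..}. f v)"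
proof -
  have img: "range exp = {0::real<..}"
    by (auto simp: image_iff) (metis exp_ln)
  have cov: "((\<lambda>y. exp y *\<^sub>R f (exp y)) absolutely_integrable_on UNIV \<and>
        integral UNIV (\<lambda>y. exp y *\<^sub>R f (exp y)) = b) \<longleftrightarrow>
        (f absolutely_integrable_on {0<..} \<and> integral {0<..} f = b)" for b
    using has_absolute_integral_change_of_variables_real[of UNIV exp exp f b]
    by (simp add: img inj_on_def DERIV_exp)
  have m: "(\<lambda>y. exp y *\<^sub>R f (exp y)) \<in> borel_measurable lborel"
    "(\<lambda>x. indicator {0::real<..} x *\<^sub>R f x) \<in> borel_measurable lborel" by measurable
  have i1: "(\<lambda>y. exp y *\<^sub>R f (exp y)) absolutely_integrable_on UNIV \<longleftrightarrow>
      integrable lborel (\<lambda>y. exp y *\<^sub>R f (exp y))"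
    using m by (simp add: set_integrable_def integrable_completion)
  have i2: "f absolutely_integrable_on {0<..} \<longleftrightarrow> set_integrable lborel {0<..} f"
    using m by (simp add: set_integrable_def integrable_completion)
  show iff: "integrable lborel (\<lambda>y. exp y *\<^sub>R f (exp y)) \<longleftrightarrow> set_integrable lborel {0<..} f"
    using cov i1 i2 by blast
  show "(LBINT y. exp y *\<^sub>R f (exp y)) = (LBINT v:{0<..}. f v)"
  proof (cases "set_integrable lborel {0<..} f")
    case True
    with iff i1 i2 cov have "integral UNIV (\<lambda>y. exp y *\<^sub>R f (exp y)) = integral {0<..} f" by blast
    moreover have "integral UNIV (\<lambda>y. exp y *\<^sub>R f (exp y)) = (LBINT y. exp y *\<^sub>R f (exp y))"
      using iff True by (simp add: integral_lborel)
    moreover have "(LBINT v:{0<..}. f v) = integral {0<..} f"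
      using True by (rule set_borel_integral_eq_integral)
    ultimately show ?thesis by simp
  next
    case False
    with iff show ?thesis
      by (simp add: not_integrable_integral_eq set_integrable_def set_lebesgue_integral_def)
  qed
qed

lemma not_nonpos_Int_if_Re_pos: "Re z > 0 \<Longrightarrow> z \<notin> \<int>\<^sub>\<le>\<^sub>0"
  by (auto elim!: nonpos_Ints_cases)

text \<open>
  Euler's integral in the variable \<open>y = ln t\<close>. In this form \<open>t \<mapsto> \<Gamma>(a + \<i> t)\<close> is visibly a Fourier
  transform, and multiplying Gamma functions amounts to convolving on the real line.
\<close>

lemma has_bochner_integral_Gamma_exp:
  assumes "Re z > 0"
  shows "has_bochner_integral lborel (\<lambda>y. exp (z * of_real y - of_real (exp y))) (Gamma z)"
proof -
  let ?f = "\<lambda>t::real. of_real t powr (z - 1) / of_real (exp t) :: complex"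
  have [measurable]: "?f \<in> borel_measurable borel" 
    unfolding powr_def by measurable
  have eq: "exp y *\<^sub>R ?f (exp y) = exp (z * of_real y - of_real (exp y))" for y
  proof -
    have "exp y *\<^sub>R ?f (exp y) = exp (of_real y) * (exp ((z - 1) * of_real y) / exp (of_real (exp y)))"
      by (simp add: powr_def scaleR_conv_of_real Ln_of_real exp_of_real)
    also have "\<dots> = exp (of_real y + (z - 1) * of_real y - of_real (exp y))"
      by (simp add: exp_add exp_diff)
    also have "of_real y + (z - 1) * of_real y = z * of_real y" by (simp add: algebra_simps)
    finally show ?thesis .
  qed
  have ai: "?f absolutely_integrable_on {0<..}"
    using absolutely_integrable_Gamma_integral'[OF assms] .
  hence si: "set_integrable lborel {0<..} ?f"
    by (simp add: set_integrable_def integrable_completion)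
  have "(LBINT v:{0<..}. ?f v) = Gamma z"
    using set_borel_integral_eq_integral(2)[OF si] integral_unique[OF Gamma_integral_complex'[OF assms]] by simp
  thus ?thesis
    using lborel_integral_exp_substitution[of ?f] si
    by (simp add: has_bochner_integral_iff eq)
qed

lemma has_bochner_integral_Gamma_exp_scaled:
  assumes "Re z > 0" and "c > 0"
  shows "has_bochner_integral lborel (\<lambda>y. exp (z * of_real y - of_real (c * exp y)))
           (of_real c powr (- z) * Gamma z)"
proof -
  let ?f = "\<lambda>y. exp (z * of_real y - of_real (exp y)) :: complex"
  have "has_bochner_integral lborel (\<lambda>y. ?f (ln c + 1 * y)) (Gamma z /\<^sub>R \<bar>1\<bar>)"
    using has_bochner_integral_Gamma_exp[OF assms(1)]
    by (subst lborel_has_bochner_integral_real_affine_iff[symmetric]) auto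
  hence "has_bochner_integral lborel (\<lambda>y. of_real c powr (- z) * ?f (ln c + y)) (of_real c powr (- z) * Gamma z)"
    by (intro has_bochner_integral_mult_right) simp
  moreover have "of_real c powr (- z) * ?f (ln c + y) = exp (z * of_real y - of_real (c * exp y))" for y
  proof -
    have "of_real c powr (- z) * ?f (ln c + y) =
       exp (- z * of_real (ln c) + (z * of_real (ln c + y) - of_real (exp (ln c + y))))"
      using assms by (subst exp_add) (simp add: powr_def Ln_of_real)
    also have "- z * of_real (ln c) + (z * of_real (ln c + y) - of_real (exp (ln c + y))) =
        z * of_real y - of_real (c * exp y)"
      using assms by (simp add: exp_add algebra_simps)
    finally show ?thesis .
  qed
  ultimately show ?thesis by simp
qed

lemma lborel_integral_translate:
  fixes f :: "real \<Rightarrow> 'a::{banach, second_countable_topology}"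
  shows "(LBINT y. f (y + c)) = (LBINT y. f y)"
    and "integrable lborel (\<lambda>y. f (y + c)) \<longleftrightarrow> integrable lborel f"
  using lborel_integral_real_affine[of 1 f c] lborel_integrable_real_affine_iff[of 1 f c]
  by (simp_all add: add.commute)

text \<open>
  The Beta integral over \<open>(0, \<infinity>)\<close> in logarithmic form. The product of the two Gamma integrals is a double
  integral; after the translation \<open>p \<mapsto> p + q\<close> in the first of them, the inner integral over \<open>q\<close> is
  again Euler's integral, for \<open>\<Gamma>(z + w)\<close>, with \<open>e\<^sup>q\<close> scaled by \<open>1 + e\<^sup>p\<close>.
\<close>

lemma has_bochner_integral_Beta_exp:
  fixes z w :: complex
  assumes z: "Re z > 0" and w: "Re w > 0"
  shows "has_bochner_integral lborel
     (\<lambda>y. exp (z * of_real y) * of_real (1 + exp y) powr (- (z + w))) (Beta z w)"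
proof -
  let ?F = "\<lambda>z y. exp (z * of_real y - of_real (exp y)) :: complex"
  let ?G = "\<lambda>q p. ?F w q * ?F z (p + q)"
  have nF: "norm (?F z y) = exp (Re z * y - exp y)" for z y by simp
  have int: "integrable lborel (?F z)" "(LBINT y. ?F z y) = Gamma z" if "Re z > 0" for z
    using has_bochner_integral_Gamma_exp[OF that] by (auto simp: has_bochner_integral_iff)
  have [measurable]: "(\<lambda>(q, p). ?G q p) \<in> borel_measurable (lborel \<Otimes>\<^sub>M lborel)"
    by measurable
  have trans: "(LBINT p. ?F z (p + q)) = Gamma z" "integrable lborel (\<lambda>p. ?F z (p + q))" for q
    using lborel_integral_translate[of "?F z" q] int[OF z] by simp_all
  have transn: "(LBINT p. norm (?F z (p + q))) = (LBINT p. norm (?F z p))" for q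
    by (rule lborel_integral_translate)
  have I: "integrable (lborel \<Otimes>\<^sub>M lborel) (\<lambda>(q, p). ?G q p)"
  proof (rule lborel_pair.Fubini_integrable)
    show "integrable lborel (\<lambda>q. LBINT p. norm (case (q, p) of (q, p) \<Rightarrow> ?G q p))"
      unfolding prod.case norm_mult integral_mult_right_zero transn
      by (intro integrable_mult_left integrable_norm int w)
    show "AE q in lborel. integrable lborel (\<lambda>p. case (q, p) of (q, p) \<Rightarrow> ?G q p)"
      unfolding prod.case by (intro AE_I2 integrable_mult_right trans)
  qed simp
  have G_eq: "?G q p = exp (z * of_real p) * exp ((z + w) * of_real q - of_real ((1 + exp p) * exp q))" for q p
    unfolding exp_add[symmetric] by (simp add: algebra_simps exp_add)
  have inner: "(LBINT q. ?G q p) =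
      exp (z * of_real p) * (of_real (1 + exp p) powr (- (z + w)) * Gamma (z + w))" for p
    unfolding G_eq integral_mult_right_zero
    using has_bochner_integral_Gamma_exp_scaled[of "z + w" "1 + exp p"] z w
    by (simp add: has_bochner_integral_iff add_pos_pos)
  have "integrable lborel (\<lambda>p. LBINT q. ?G q p)"
    by (rule lborel_pair.integrable_snd[OF I])
  moreover have "(LBINT p. LBINT q. ?G q p) = Gamma z * Gamma w"
    unfolding lborel_pair.Fubini_integral[OF I] integral_mult_right_zero trans(1)
      integral_mult_left_zero int(2)[OF w] by (rule mult.commute)
  ultimately have "has_bochner_integral lborel
     (\<lambda>p. exp (z * of_real p) * (of_real (1 + exp p) powr (- (z + w)) * Gamma (z + w))) (Gamma z * Gamma w)"
    unfolding inner by (simp add: has_bochner_integral_iff)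
  hence "has_bochner_integral lborel
     (\<lambda>p. exp (z * of_real p) * (of_real (1 + exp p) powr (- (z + w)) * Gamma (z + w)) * inverse (Gamma (z + w)))
      (Gamma z * Gamma w * inverse (Gamma (z + w)))" by (intro has_bochner_integral_mult_left)
  moreover have "Gamma (z + w) \<noteq> 0"
    using z w not_nonpos_Int_if_Re_pos[of "z + w"] by (simp add: Gamma_eq_zero_iff)
  ultimately show ?thesis by (simp add: Beta_def field_simps)
qed

text \<open>
  The function \<open>x\<^sup>a (1 + x) powr (- a - b)\<close> at \<open>x = e\<^sup>y\<close>; up to normalisation, the density of \<open>ln x\<close>
  when \<open>x\<close> has a type-2 beta density.
\<close>

definition log_beta_kernel :: "real \<Rightarrow> real \<Rightarrow> real \<Rightarrow> real" where
  "log_beta_kernel a b y = exp (a * y) * (1 + exp y) powr (- (a + b))"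

lemma continuous_log_beta_kernel: "continuous_on A (log_beta_kernel a b)"
  unfolding log_beta_kernel_def
  by (intro continuous_intros) (auto simp: add_pos_pos less_imp_neq[symmetric])

lemma measurable_log_beta_kernel [measurable]: "log_beta_kernel a b \<in> borel_measurable borel"
  by (intro borel_measurable_continuous_onI continuous_log_beta_kernel)

lemma log_beta_kernel_nonneg: "log_beta_kernel a b y \<ge> 0"
  by (simp add: log_beta_kernel_def)

lemma log_beta_kernel_le_1:
  assumes "a > 0" "b > 0"
  shows "log_beta_kernel a b y \<le> 1"
proof -
  have "exp (a * y) = exp y powr a" by (simp add: powr_def)
  also have "\<dots> \<le> (1 + exp y) powr a" using assms by (intro powr_mono2) auto
  also have "\<dots> \<le> (1 + exp y) powr (a + b)" using assms by (intro powr_mono) auto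
  finally have "exp (a * y) * (1 + exp y) powr (- (a + b)) \<le>
     (1 + exp y) powr (a + b) * (1 + exp y) powr (- (a + b))"
    by (intro mult_right_mono) auto
  also have "\<dots> = 1" using exp_gt_zero[of y] by (simp add: powr_add[symmetric] del: exp_gt_zero)
  finally show ?thesis by (simp add: log_beta_kernel_def)
qed

lemma Gamma_product_eq_fourier:
  fixes a b t :: real
  assumes "a > 0" "b > 0"
  shows "has_bochner_integral lborel (\<lambda>y. Gamma (a + b) * log_beta_kernel a b y * iexp (t * y))
     (Gamma (a + \<i> * t) * Gamma (b - \<i> * t))"
proof -
  let ?z = "a + \<i> * t" and ?w = "b - \<i> * t"
  have "has_bochner_integral lborel
     (\<lambda>y. Gamma (?z + ?w) * (exp (?z * of_real y) * of_real (1 + exp y) powr (- (?z + ?w)))) (Gamma (?z + ?w) * Beta ?z ?w)"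
    using assms by (intro has_bochner_integral_mult_right has_bochner_integral_Beta_exp) auto
  moreover have "Gamma (?z + ?w) * (exp (?z * of_real y) * of_real (1 + exp y) powr (- (?z + ?w))) =
     Gamma (a + b) * log_beta_kernel a b y * iexp (t * y)" for y
  proof -
    have "complex_of_real (1 + exp y) powr (- of_real (a + b)) = of_real ((1 + exp y) powr (- (a + b)))"
      using exp_gt_zero[of y] by (subst powr_of_real[symmetric]) (auto simp del: exp_gt_zero)
    moreover have "exp (?z * of_real y) = of_real (exp (a * y)) * exp (\<i> * (t * y))"
      by (simp add: exp_of_real[symmetric] exp_add[symmetric] algebra_simps)
    moreover have "?z + ?w = of_real (a + b)" by simp
    ultimately show ?thesis 
      by (simp only: Gamma_complex_of_real log_beta_kernel_def) (simp add: algebra_simps)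
  qed
  moreover have "Gamma (of_real (a + b)) \<noteq> (0::complex)"
  proof -
    have "Gamma (a + b) > 0" using assms by (intro Gamma_real_pos) auto
    thus ?thesis unfolding Gamma_complex_of_real by simp
  qed
  ultimately show ?thesis by (simp add: Beta_def)
qed

lemma integrable_log_beta_kernel:
  assumes "a > 0" "b > 0"
  shows "integrable lborel (log_beta_kernel a b)"
proof -
  have "integrable lborel (\<lambda>y. norm (Gamma (a + b) * log_beta_kernel a b y * exp (\<i> * (0 * y))))"
    using Gamma_product_eq_fourier[OF assms, of 0]
    by (intro integrable_norm) (simp add: has_bochner_integral_iff)
  moreover have "Gamma (a + b) > 0" using assms by (simp add: Gamma_real_pos)
  ultimately show ?thesis
    by (simp add: norm_mult log_beta_kernel_nonneg Gamma_complex_of_real flip: of_real_add)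
qed

section \<open>Decay of the Gamma function on vertical lines\<close>

lemma integrable_inverse_1_plus_square_lborel:
  "integrable lborel (\<lambda>t::real. inverse (1 + t\<^sup>2))"
  using integrable_inverse_1_plus_square by (simp add: set_integrable_def)

lemma norm_Gamma_le_Re:
  assumes "Re z > 0"
  shows "norm (Gamma z) \<le> Gamma (Re z)"
proof -
  have 1: "has_bochner_integral lborel (\<lambda>y. exp (z * of_real y - of_real (exp y))) (Gamma z)"
    by (rule has_bochner_integral_Gamma_exp[OF assms])
  have 2: "has_bochner_integral lborel (\<lambda>y. exp (of_real (Re z) * of_real y - of_real (exp y))) (Gamma (of_real (Re z)) :: complex)"
    using assms by (intro has_bochner_integral_Gamma_exp) simp
  have "norm (Gamma z) \<le> (LBINT y. norm (exp (z * of_real y - of_real (exp y))))"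
    using 1 integral_norm_bound[of lborel "\<lambda>y. exp (z * of_real y - of_real (exp y))"]
    by (simp add: has_bochner_integral_iff)
  also have "of_real \<dots> = (LBINT y. exp (of_real (Re z) * of_real y - of_real (exp y)) :: complex)"
    by (subst integral_complex_of_real[symmetric]) (simp add: exp_of_real[symmetric])
  hence "(LBINT y. norm (exp (z * of_real y - of_real (exp y)))) = Gamma (Re z)"
    using 2 by (simp add: has_bochner_integral_iff Gamma_complex_of_real of_real_eq_iff del: norm_exp_eq_Re)
  finally show ?thesis .
qed

text \<open>
  Two applications of the functional equation trade the factor \<open>z (z + 1)\<close>, of size at least \<open>t\<^sup>2\<close>,
  for a shift of the argument by 2, where the Gamma function is still bounded by its value on the real
  axis. Quadratic decay is all that integrability needs.
\<close>

lemma norm_Gamma_vertical_decay: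
  fixes a t :: real
  assumes "a > 0"
  shows "norm (Gamma (a + \<i> * t)) * (1 + t\<^sup>2) \<le> Gamma a + Gamma (a + 2)"
proof -
  let ?z = "a + \<i> * t"
  have nz: "?z \<noteq> 0" "?z + 1 \<noteq> 0" using assms by (auto simp: complex_eq_iff)
  have "Gamma (?z + 2) = (?z + 1) * ?z * Gamma ?z"
    using Gamma_plus1[of "?z + 1"] Gamma_plus1[of ?z] assms
      not_nonpos_Int_if_Re_pos[of ?z] not_nonpos_Int_if_Re_pos[of "?z + 1"]
    by (simp add: add.assoc)
  hence "norm (?z + 1) * norm ?z * norm (Gamma ?z) = norm (Gamma (?z + 2))" by (simp add: norm_mult)
  also have "\<dots> \<le> Gamma (a + 2)" using norm_Gamma_le_Re[of "?z + 2"] assms by simp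
  finally have *: "norm (?z + 1) * norm ?z * norm (Gamma ?z) \<le> Gamma (a + 2)" .
  have "t\<^sup>2 = \<bar>Im (?z + 1)\<bar> * \<bar>Im ?z\<bar>" by (simp add: power2_eq_square)
  also have "\<dots> \<le> norm (?z + 1) * norm ?z" by (intro mult_mono abs_Im_le_cmod) auto
  finally have "t\<^sup>2 * norm (Gamma ?z) \<le> norm (?z + 1) * norm ?z * norm (Gamma ?z)"
    by (intro mult_right_mono) auto
  with * norm_Gamma_le_Re[of ?z] assms show ?thesis by (simp add: algebra_simps)
qed

lemma measurable_Gamma_line [measurable]:
  fixes a :: real
  shows "a > 0 \<Longrightarrow> (\<lambda>t::real. Gamma (a + \<i> * t)) \<in> borel_measurable borel"
    and "a > 0 \<Longrightarrow> (\<lambda>t::real. Gamma (a - \<i> * t)) \<in> borel_measurable borel"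
proof -
  show "(\<lambda>t::real. Gamma (a + \<i> * t)) \<in> borel_measurable borel" if "a > 0"
    using that
    by (intro borel_measurable_continuous_onI continuous_on_compose2[OF continuous_on_Gamma[of "- \<int>\<^sub>\<le>\<^sub>0"]]
          continuous_intros) (auto elim!: notE[OF not_nonpos_Int_if_Re_pos, rotated])
  show "(\<lambda>t::real. Gamma (a - \<i> * t)) \<in> borel_measurable borel" if "a > 0"
    using that
    by (intro borel_measurable_continuous_onI continuous_on_compose2[OF continuous_on_Gamma[of "- \<int>\<^sub>\<le>\<^sub>0"]]
          continuous_intros) (auto elim!: notE[OF not_nonpos_Int_if_Re_pos, rotated])
qed

lemma integrable_Gamma_product:
  fixes a b :: real
  assumes "a > 0" "b > 0"
  shows "integrable lborel (\<lambda>t::real. Gamma (a + \<i> * t) * Gamma (b - \<i> * t))"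
proof (rule Bochner_Integration.integrable_bound)
  show "integrable lborel (\<lambda>t::real. (Gamma a + Gamma (a + 2)) * Gamma b * inverse (1 + t\<^sup>2))"
    by (intro integrable_mult_right integrable_inverse_1_plus_square_lborel)
  show "(\<lambda>t::real. Gamma (a + \<i> * t) * Gamma (b - \<i> * t)) \<in> borel_measurable lborel"
    using measurable_Gamma_line assms by measurable
  show "AE t in lborel. norm (Gamma (a + \<i> * t) * Gamma (b - \<i> * t))
      \<le> norm ((Gamma a + Gamma (a + 2)) * Gamma b * inverse (1 + t\<^sup>2))"
  proof (rule AE_I2)
    fix t :: real
    have pos: "Gamma a > 0" "Gamma (a + 2) > 0" "Gamma b > 0" "1 + t\<^sup>2 > 0"
      using assms by (auto intro!: Gamma_real_pos add_pos_nonneg)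
    have 1: "norm (Gamma (a + \<i> * t)) \<le> (Gamma a + Gamma (a + 2)) / (1 + t\<^sup>2)"
      using norm_Gamma_vertical_decay[OF assms(1), of t] pos by (simp add: pos_le_divide_eq)
    have 2: "norm (Gamma (b - \<i> * t)) \<le> Gamma b"
      using norm_Gamma_le_Re[of "b - \<i> * t"] assms by simp
    have "norm (Gamma (a + \<i> * t) * Gamma (b - \<i> * t)) \<le> (Gamma a + Gamma (a + 2)) / (1 + t\<^sup>2) * Gamma b"
      unfolding norm_mult using pos by (intro mult_mono 1 2) auto
    also have "\<dots> = norm ((Gamma a + Gamma (a + 2)) * Gamma b * inverse (1 + t\<^sup>2))"
      using pos by (simp add: divide_inverse abs_mult)
    finally show "norm (Gamma (a + \<i> * t) * Gamma (b - \<i> * t))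
      \<le> norm ((Gamma a + Gamma (a + 2)) * Gamma b * inverse (1 + t\<^sup>2))" .
  qed
qed

section \<open>Fourier inversion\<close>

lemma fourier_gaussian:
  fixes e x :: real
  assumes "e > 0"
  shows "(LBINT t. exp (- (e * t)\<^sup>2 / 2) * exp (\<i> * (x * t))) =
           complex_of_real (2 * pi) * complex_of_real (normal_density 0 e x)"
proof -
  have std: "(LBINT s. of_real (std_normal_density s) * exp (\<i> * (y * s))) = complex_of_real (exp (- y\<^sup>2 / 2))" for y
  proof -
    have "char std_normal_distribution y = (LBINT s. of_real (std_normal_density s) * exp (\<i> * (y * s)))"
      unfolding char_def
      by (subst integral_density) (auto simp: scaleR_conv_of_real)
    thus ?thesis by (simp add: char_std_normal_distribution)
  qed
  have "(LBINT t. exp (- (e * t)\<^sup>2 / 2) * exp (\<i> * (x * t))) =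
      \<bar>1 / e\<bar> *\<^sub>R (LBINT s. exp (- (e * (0 + 1 / e * s))\<^sup>2 / 2) * exp (\<i> * (x * (0 + 1 / e * s))))"
    using assms by (subst lborel_integral_real_affine[of "1/e" _ 0]) auto
  also have "(LBINT s. exp (- (e * (0 + 1 / e * s))\<^sup>2 / 2) * exp (\<i> * (x * (0 + 1 / e * s)))) =
     (LBINT s. sqrt (2 * pi) * (of_real (std_normal_density s) * exp (\<i> * ((x / e) * s))))"
    using assms by (intro Bochner_Integration.integral_cong refl) (simp add: std_normal_density_def)
  also have "\<dots> = complex_of_real (sqrt (2 * pi)) * of_real (exp (- (x / e)\<^sup>2 / 2))"
    unfolding std[symmetric] by (rule integral_mult_right_zero)
  also have "\<bar>1 / e\<bar> *\<^sub>R \<dots> = complex_of_real (2 * pi) * complex_of_real (normal_density 0 e x)"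
  proof -
    have "1 / e * (sqrt (2 * pi) * exp (- (x / e)\<^sup>2 / 2)) = 2 * pi * normal_density 0 e x"
      using assms by (simp add: normal_density_def real_sqrt_mult field_simps power_divide power2_eq_square)
    moreover have "\<bar>1 / e\<bar> *\<^sub>R (complex_of_real (sqrt (2 * pi)) * of_real (exp (- (x / e)\<^sup>2 / 2))) =
        complex_of_real (1 / e * (sqrt (2 * pi) * exp (- (x / e)\<^sup>2 / 2)))"
      using assms by (simp add: scaleR_conv_of_real)
    ultimately show ?thesis by (simp only: of_real_mult)
  qed
  finally show ?thesis .
qed

text \<open>
  Multiplying \<open>F\<close> by a Gaussian of width \<open>1 / \<epsilon>\<close> makes the double integral absolutely convergent. Fubini
  then turns the inversion integral into the average of \<open>h\<close> against a normal density of standard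
  deviation \<open>\<epsilon>\<close> around \<open>x\<close>. As \<open>\<epsilon> \<rightarrow> 0\<close>, both sides converge by dominated convergence: the left because
  \<open>F\<close> is integrable, the right because \<open>h\<close> is bounded and continuous.
\<close>

lemma fourier_inversion:
  fixes h :: "real \<Rightarrow> complex" and F :: "real \<Rightarrow> complex"
  assumes h_int: "integrable lborel h" and h_cont: "continuous_on UNIV h"
    and h_bound: "\<And>y. norm (h y) \<le> M"
    and F: "\<And>t. F t = (LBINT y. h y * iexp (t * y))"
    and F_int: "integrable lborel F"
  shows "(LBINT t. F t * exp (- (\<i> * of_real (x * t)))) = complex_of_real (2 * pi) * h x"
proof -
  \<comment> \<open>The width \<open>\<epsilon>\<close> runs through a null sequence.\<close>
  define e :: "nat \<Rightarrow> real" where "e n = 1 / (real n + 1)" for n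
  have e_pos: "e n > 0" for n by (simp add: e_def)
  have e_lim: "e \<longlonglongrightarrow> 0" unfolding e_def by real_asymp
  have [measurable]: "F \<in> borel_measurable borel" "h \<in> borel_measurable borel"
    using F_int h_int by (auto dest: borel_measurable_integrable)
  define g where "g = (\<lambda>n t. F t * exp (- (\<i> * of_real (x * t))) * exp (- (e n * t)\<^sup>2 / 2))"
  have lim1: "(\<lambda>n. LBINT t. g n t) \<longlonglongrightarrow> (LBINT t. F t * exp (- (\<i> * of_real (x * t))))"
  proof (rule integral_dominated_convergence[where w = "\<lambda>t. norm (F t)"])
    show "integrable lborel (\<lambda>t. norm (F t))" using F_int by simp
    show "AE t in lborel. (\<lambda>n. g n t) \<longlonglongrightarrow> F t * exp (- (\<i> * of_real (x * t)))"
    proof (rule AE_I2)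
      fix t
      have "(\<lambda>n. g n t) \<longlonglongrightarrow> F t * exp (- (\<i> * of_real (x * t))) * exp (- (0 * t)\<^sup>2 / 2)"
        unfolding g_def by (intro tendsto_intros e_lim) simp
      thus "(\<lambda>n. g n t) \<longlonglongrightarrow> F t * exp (- (\<i> * of_real (x * t)))" by simp
    qed
    show "AE t in lborel. norm (g n t) \<le> norm (F t)" for n
      by (rule AE_I2) (auto simp: g_def norm_mult intro!: mult_left_le)
  qed (auto simp: g_def)
  have eq: "(LBINT t. g n t) = complex_of_real (2 * pi) * (LBINT s. h (x + e n * s) * std_normal_density s)" for n
  proof -
    let ?K = "\<lambda>t y. h y * (exp (- (e n * t)\<^sup>2 / 2) * exp (\<i> * ((y - x) * t)))"
    have gauss_int: "integrable lborel (\<lambda>t. exp (- (e n * t)\<^sup>2 / 2))"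
    proof -
      have "integrable lborel (\<lambda>t. sqrt (2 * pi) * std_normal_density (0 + e n * t))"
        using e_pos[of n] by (intro integrable_mult_right)
          (subst lborel_integrable_real_affine_iff, auto)
      thus ?thesis by (simp add: std_normal_density_def)
    qed
    have I: "integrable (lborel \<Otimes>\<^sub>M lborel) (\<lambda>(t, y). ?K t y)"
    proof (rule lborel_pair.Fubini_integrable)
      show "integrable lborel (\<lambda>t. LBINT y. norm (case (t, y) of (t, y) \<Rightarrow> ?K t y))"
        using gauss_int by (simp add: norm_mult)
      show "AE t in lborel. integrable lborel (\<lambda>y. case (t, y) of (t, y) \<Rightarrow> ?K t y)"
        unfolding prod.case
      proof (rule AE_I2, rule Bochner_Integration.integrable_bound[OF h_int])
        show "AE y in lborel. norm (?K t y) \<le> norm (h y)" for t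
          by (rule AE_I2) (auto simp: norm_mult intro!: mult_left_le)
      qed measurable
    qed measurable
    have "(LBINT t. g n t) = (LBINT t. LBINT y. ?K t y)"
    proof (rule Bochner_Integration.integral_cong[OF refl])
      fix t
      have "(LBINT y. ?K t y) = (LBINT y. (h y * exp (\<i> * (t * y))) * (exp (- (\<i> * of_real (x * t))) * exp (- (e n * t)\<^sup>2 / 2)))"
        by (intro Bochner_Integration.integral_cong refl)
           (simp add: mult_ac exp_add[symmetric] ring_distribs flip: exp_minus)
      also have "\<dots> = g n t" by (subst integral_mult_left_zero) (simp only: F g_def mult.assoc)
      finally show "g n t = (LBINT y. ?K t y)" ..
    qed
    also have "\<dots> = (LBINT y. LBINT t. ?K t y)"
      by (rule lborel_pair.Fubini_integral[OF I, symmetric])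
    also have "\<dots> = (LBINT y. complex_of_real (2 * pi) * (h y * complex_of_real (normal_density 0 (e n) (y - x))))"
      by (intro Bochner_Integration.integral_cong refl, subst integral_mult_right_zero,
          subst fourier_gaussian[OF e_pos]) (simp add: mult_ac)
    also have "\<dots> = \<bar>e n\<bar> *\<^sub>R (LBINT s. complex_of_real (2 * pi) * (h (x + e n * s) * complex_of_real (normal_density 0 (e n) (x + e n * s - x))))"
      using e_pos[of n] by (intro lborel_integral_real_affine) auto
    also have "\<dots> = (LBINT s. complex_of_real (2 * pi) * (h (x + e n * s) * (e n * normal_density 0 (e n) (x + e n * s - x))))"
      using e_pos[of n] by (subst integral_scaleR_right[symmetric]) (simp add: scaleR_conv_of_real mult_ac)
    also have "\<dots> = (LBINT s. complex_of_real (2 * pi) * (h (x + e n * s) * std_normal_density s))"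
    proof -
      have "e n * normal_density 0 (e n) (x + e n * s - x) = std_normal_density s" for s
        using e_pos[of n] by (simp add: normal_density_def real_sqrt_mult power_mult_distrib)
      thus ?thesis by (simp only: of_real_mult[symmetric])
    qed
    finally show ?thesis by (simp only: integral_mult_right_zero)
  qed
  have lim2: "(\<lambda>n. LBINT s. h (x + e n * s) * std_normal_density s) \<longlonglongrightarrow> (LBINT s. h x * std_normal_density s)"
  proof (rule integral_dominated_convergence[where w = "\<lambda>s. M * std_normal_density s"])
    show "integrable lborel (\<lambda>s. M * std_normal_density s)" by (intro integrable_mult_right) simp
    show "AE s in lborel. (\<lambda>n. h (x + e n * s) * std_normal_density s) \<longlonglongrightarrow> h x * std_normal_density s"
    proof (rule AE_I2)
      fix s
      have "(\<lambda>n. x + e n * s) \<longlonglongrightarrow> x" using e_lim by (auto intro!: tendsto_eq_intros)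
      hence "(\<lambda>n. h (x + e n * s)) \<longlonglongrightarrow> h x"
        using h_cont by (intro isCont_tendsto_compose[of x h]) (auto simp: continuous_on_eq_continuous_at)
      thus "(\<lambda>n. h (x + e n * s) * std_normal_density s) \<longlonglongrightarrow> h x * std_normal_density s"
        by (intro tendsto_intros)
    qed
    show "AE s in lborel. norm (h (x + e n * s) * std_normal_density s) \<le> M * std_normal_density s" for n
      by (rule AE_I2) (auto simp: norm_mult intro!: mult_right_mono h_bound)
  qed measurable
  have "(LBINT s. h x * std_normal_density s) = h x"
    using integral_complex_of_real[of lborel std_normal_density]
    by (simp add: integral_normal_density)
  with lim2 have "(\<lambda>n. LBINT t. g n t) \<longlonglongrightarrow> complex_of_real (2 * pi) * h x"
    unfolding eq by (intro tendsto_intros) auto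
  with lim1 show ?thesis by (rule LIMSEQ_unique)
qed

section \<open>The Mellin--Barnes integral as a real integral\<close>

text \<open>
  The integrand of Barnes' first lemma. The function \<open>z powr (- s)\<close> is kept as a separate factor.
\<close>

definition barnes_integrand :: "real \<Rightarrow> real \<Rightarrow> real \<Rightarrow> real \<Rightarrow> complex \<Rightarrow> complex" where
  "barnes_integrand a\<^sub>1 a\<^sub>2 b\<^sub>1 b\<^sub>2 s = Gamma (a\<^sub>1 + s) * Gamma (a\<^sub>2 + s) * Gamma (b\<^sub>1 - s) * Gamma (b\<^sub>2 - s)"

lemma continuous_on_barnes_vertical:
  fixes a\<^sub>1 a\<^sub>2 b\<^sub>1 b\<^sub>2 c :: real
  assumes "a\<^sub>1 + c \<notin> \<int>\<^sub>\<le>\<^sub>0" "a\<^sub>2 + c \<notin> \<int>\<^sub>\<le>\<^sub>0" "b\<^sub>1 - c \<notin> \<int>\<^sub>\<le>\<^sub>0" "b\<^sub>2 - c \<notin> \<int>\<^sub>\<le>\<^sub>0"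
  shows "continuous_on UNIV (\<lambda>t. barnes_integrand a\<^sub>1 a\<^sub>2 b\<^sub>1 b\<^sub>2 (Complex c t))"
proof -
  have 1: "complex_of_real a + Complex c t \<notin> \<int>\<^sub>\<le>\<^sub>0" if "a + c \<notin> \<int>\<^sub>\<le>\<^sub>0" for a t
  proof
    assume "complex_of_real a + Complex c t \<in> \<int>\<^sub>\<le>\<^sub>0"
    then obtain n where "complex_of_real a + Complex c t = of_int n" "n \<le> 0" by (auto elim!: nonpos_Ints_cases)
    hence "a + c = of_int n" by (simp add: complex_eq_iff)
    with that \<open>n \<le> 0\<close> show False by (simp add: nonpos_Ints_def)
  qed
  have 2: "complex_of_real b - Complex c t \<notin> \<int>\<^sub>\<le>\<^sub>0" if "b - c \<notin> \<int>\<^sub>\<le>\<^sub>0" for b t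
  proof
    assume "complex_of_real b - Complex c t \<in> \<int>\<^sub>\<le>\<^sub>0"
    then obtain n where "complex_of_real b - Complex c t = of_int n" "n \<le> 0" by (auto elim!: nonpos_Ints_cases)
    hence "b - c = of_int n" by (simp add: complex_eq_iff)
    with that \<open>n \<le> 0\<close> show False by (simp add: nonpos_Ints_def)
  qed
  have "continuous_on UNIV (Complex c)" unfolding Complex_eq by (intro continuous_intros)
  thus ?thesis unfolding barnes_integrand_def using 1 2 assms
    by (intro continuous_intros continuous_on_compose2[OF continuous_on_Gamma[of "- \<int>\<^sub>\<le>\<^sub>0"]]) auto
qed

lemma norm_Gamma_pair_bounded:
  fixes a b t :: real
  assumes "a > 0" "b > 0"
  shows "norm (Gamma (a + \<i> * t) * Gamma (b - \<i> * t)) \<le> Gamma a * Gamma b"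
  unfolding norm_mult
  using norm_Gamma_le_Re[of "a + \<i> * t"] norm_Gamma_le_Re[of "b - \<i> * t"] assms Gamma_real_pos[of a] Gamma_real_pos[of b]
  by (intro mult_mono) auto

text \<open>
  One pair of Gamma functions supplies the decay, the other is bounded.
\<close>

lemma integrable_barnes_line:
  fixes a\<^sub>1 a\<^sub>2 b\<^sub>1 b\<^sub>2 :: real
  assumes "a\<^sub>1 > 0" "a\<^sub>2 > 0" "b\<^sub>1 > 0" "b\<^sub>2 > 0"
  shows "integrable lborel (\<lambda>t::real. barnes_integrand a\<^sub>1 a\<^sub>2 b\<^sub>1 b\<^sub>2 (\<i> * t))"
proof (rule Bochner_Integration.integrable_bound)
  show "integrable lborel (\<lambda>t::real. of_real (Gamma a\<^sub>2 * Gamma b\<^sub>2) * (Gamma (a\<^sub>1 + \<i> * t) * Gamma (b\<^sub>1 - \<i> * t)))"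
    by (intro integrable_mult_right integrable_Gamma_product assms)
  have "continuous_on UNIV (\<lambda>t. barnes_integrand a\<^sub>1 a\<^sub>2 b\<^sub>1 b\<^sub>2 (Complex 0 t))"
    using assms by (intro continuous_on_barnes_vertical) (auto elim!: nonpos_Ints_cases)
  thus "(\<lambda>t::real. barnes_integrand a\<^sub>1 a\<^sub>2 b\<^sub>1 b\<^sub>2 (\<i> * t)) \<in> borel_measurable lborel"
    by (simp add: borel_measurable_continuous_onI Complex_eq)
  show "AE t in lborel. norm (barnes_integrand a\<^sub>1 a\<^sub>2 b\<^sub>1 b\<^sub>2 (\<i> * of_real t))
    \<le> norm (of_real (Gamma a\<^sub>2 * Gamma b\<^sub>2) * (Gamma (a\<^sub>1 + \<i> * t) * Gamma (b\<^sub>1 - \<i> * t)))"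
  proof (rule AE_I2)
    fix t :: real
    have "norm (barnes_integrand a\<^sub>1 a\<^sub>2 b\<^sub>1 b\<^sub>2 (\<i> * of_real t)) =
       norm (Gamma (a\<^sub>2 + \<i> * t) * Gamma (b\<^sub>2 - \<i> * t)) * norm (Gamma (a\<^sub>1 + \<i> * t) * Gamma (b\<^sub>1 - \<i> * t))"
      by (simp add: barnes_integrand_def norm_mult mult_ac)
    also have "\<dots> \<le> (Gamma a\<^sub>2 * Gamma b\<^sub>2) * norm (Gamma (a\<^sub>1 + \<i> * t) * Gamma (b\<^sub>1 - \<i> * t))"
      using norm_Gamma_pair_bounded[OF assms(2,4), of t] by (intro mult_right_mono) auto
    also have "Gamma a\<^sub>2 * Gamma b\<^sub>2 = norm (of_real (Gamma a\<^sub>2 * Gamma b\<^sub>2) :: complex)"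
      using Gamma_real_pos[of a\<^sub>2] Gamma_real_pos[of b\<^sub>2] assms by (simp add: norm_mult)
    finally show "norm (barnes_integrand a\<^sub>1 a\<^sub>2 b\<^sub>1 b\<^sub>2 (\<i> * of_real t))
    \<le> norm (of_real (Gamma a\<^sub>2 * Gamma b\<^sub>2) * (Gamma (a\<^sub>1 + \<i> * t) * Gamma (b\<^sub>1 - \<i> * t)))"
      by (simp only: norm_mult)
  qed
qed

lemma barnes_pair_inversion:
  fixes a b x :: real
  assumes "a > 0" "b > 0"
  shows "(LBINT t. Gamma (a + \<i> * t) * Gamma (b - \<i> * t) * exp (- (\<i> * of_real (x * t)))) =
     complex_of_real (2 * pi) * complex_of_real (Gamma (a + b) * log_beta_kernel a b x)"
proof (rule fourier_inversion[where M = "Gamma (a + b)"])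
  have pos: "Gamma (a + b) > 0" using assms by (intro Gamma_real_pos) auto
  show "integrable lborel (\<lambda>y. complex_of_real (Gamma (a + b) * log_beta_kernel a b y))"
    using integrable_log_beta_kernel[OF assms] by (intro integrable_of_real integrable_mult_right)
  show "continuous_on UNIV (\<lambda>y. complex_of_real (Gamma (a + b) * log_beta_kernel a b y))"
    by (intro continuous_intros continuous_log_beta_kernel)
  show "norm (complex_of_real (Gamma (a + b) * log_beta_kernel a b y)) \<le> Gamma (a + b)" for y
    using pos log_beta_kernel_le_1[OF assms, of y] log_beta_kernel_nonneg[of a b y]
    by (simp add: norm_mult mult_left_le del: of_real_mult)
  show "Gamma (a + \<i> * t) * Gamma (b - \<i> * t) =
      (LBINT y. of_real (Gamma (a + b) * log_beta_kernel a b y) * iexp (t * y))" for t :: real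
    using Gamma_product_eq_fourier[OF assms, of t]
    by (simp add: has_bochner_integral_iff Gamma_complex_of_real flip: of_real_add)
  show "integrable lborel (\<lambda>t::real. Gamma (a + \<i> * t) * Gamma (b - \<i> * t))"
    by (rule integrable_Gamma_product[OF assms])
qed

text \<open>
  Only the second pair of Gamma functions is replaced by its Fourier integral. Exchanging the integrals
  is then justified by the integrability of the first pair, and the inner integral over \<open>t\<close> is the
  inversion formula for that pair at the point \<open>x - y\<close>.
\<close>

lemma barnes_integral_eq_convolution:
  fixes a\<^sub>1 a\<^sub>2 b\<^sub>1 b\<^sub>2 x :: real
  assumes "a\<^sub>1 > 0" "a\<^sub>2 > 0" "b\<^sub>1 > 0" "b\<^sub>2 > 0"
  shows "(LBINT t. barnes_integrand a\<^sub>1 a\<^sub>2 b\<^sub>1 b\<^sub>2 (\<i> * t) * exp (- (\<i> * of_real (x * t)))) =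
    complex_of_real (2 * pi) * of_real (Gamma (a\<^sub>1 + b\<^sub>1) * Gamma (a\<^sub>2 + b\<^sub>2) *
      (LBINT y. log_beta_kernel a\<^sub>1 b\<^sub>1 (x - y) * log_beta_kernel a\<^sub>2 b\<^sub>2 y))"
proof -
  define P where "P = (\<lambda>t::real. Gamma (a\<^sub>1 + \<i> * t) * Gamma (b\<^sub>1 - \<i> * t))"
  let ?h = "\<lambda>y. complex_of_real (Gamma (a\<^sub>2 + b\<^sub>2) * log_beta_kernel a\<^sub>2 b\<^sub>2 y)"
  let ?K = "\<lambda>t y. ?h y * (P t * exp (- (\<i> * of_real ((x - y) * t))))"
  have P_int: "integrable lborel P" unfolding P_def by (rule integrable_Gamma_product[OF assms(1,3)])
  have [measurable]: "P \<in> borel_measurable borel" using P_int by (auto dest: borel_measurable_integrable)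
  have h_int: "integrable lborel ?h"
    using integrable_log_beta_kernel[OF assms(2,4)] by (intro integrable_of_real integrable_mult_right)
  have nK: "norm (?K t y) = norm (?h y) * norm (P t)" for t y by (simp add: norm_mult)
  have I: "integrable (lborel \<Otimes>\<^sub>M lborel) (\<lambda>(t, y). ?K t y)"
  proof (rule lborel_pair.Fubini_integrable)
    show "integrable lborel (\<lambda>t. LBINT y. norm (case (t, y) of (t, y) \<Rightarrow> ?K t y))"
      unfolding prod.case nK integral_mult_left_zero using P_int by (intro integrable_mult_right) simp
    show "AE t in lborel. integrable lborel (\<lambda>y. case (t, y) of (t, y) \<Rightarrow> ?K t y)"
      unfolding prod.case
    proof (rule AE_I2)
      fix t
      show "integrable lborel (\<lambda>y. ?K t y)"
      proof (rule Bochner_Integration.integrable_bound)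
        show "integrable lborel (\<lambda>y. ?h y * P t)" using h_int by (intro integrable_mult_left)
        show "AE y in lborel. norm (?K t y) \<le> norm (?h y * P t)"
          by (rule AE_I2) (simp add: norm_mult)
      qed measurable
    qed
  qed measurable
  have "(LBINT t. barnes_integrand a\<^sub>1 a\<^sub>2 b\<^sub>1 b\<^sub>2 (\<i> * t) * exp (- (\<i> * of_real (x * t)))) = (LBINT t. LBINT y. ?K t y)"
  proof (rule Bochner_Integration.integral_cong[OF refl])
    fix t
    have F: "(LBINT y. ?h y * iexp (t * y)) = Gamma (a\<^sub>2 + \<i> * t) * Gamma (b\<^sub>2 - \<i> * t)"
      using Gamma_product_eq_fourier[OF assms(2,4), of t]
      by (simp add: has_bochner_integral_iff Gamma_complex_of_real flip: of_real_add)
    have "(LBINT y. ?K t y) = (LBINT y. (?h y * iexp (t * y)) * (P t * exp (- (\<i> * of_real (x * t)))))"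
      by (intro Bochner_Integration.integral_cong refl) (simp add: algebra_simps exp_diff exp_minus divide_inverse)
    also have "\<dots> = (Gamma (a\<^sub>2 + \<i> * t) * Gamma (b\<^sub>2 - \<i> * t)) * (P t * exp (- (\<i> * of_real (x * t))))"
      by (subst integral_mult_left_zero, subst F) (rule refl)
    also have "\<dots> = barnes_integrand a\<^sub>1 a\<^sub>2 b\<^sub>1 b\<^sub>2 (\<i> * t) * exp (- (\<i> * of_real (x * t)))"
      by (simp add: P_def barnes_integrand_def mult_ac)
    finally show "barnes_integrand a\<^sub>1 a\<^sub>2 b\<^sub>1 b\<^sub>2 (\<i> * t) * exp (- (\<i> * of_real (x * t))) = (LBINT y. ?K t y)" by simp
  qed
  also have "\<dots> = (LBINT y. LBINT t. ?K t y)"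
    by (rule lborel_pair.Fubini_integral[OF I, symmetric])
  also have "\<dots> = (LBINT y. complex_of_real (2 * pi * (Gamma (a\<^sub>1 + b\<^sub>1) * Gamma (a\<^sub>2 + b\<^sub>2)) *
      (log_beta_kernel a\<^sub>1 b\<^sub>1 (x - y) * log_beta_kernel a\<^sub>2 b\<^sub>2 y)))"
  proof (rule Bochner_Integration.integral_cong[OF refl])
    fix y
    have "(LBINT t. ?K t y) = ?h y * (LBINT t. P t * exp (- (\<i> * of_real ((x - y) * t))))"
      by (rule integral_mult_right_zero)
    also have "(LBINT t. P t * exp (- (\<i> * of_real ((x - y) * t)))) =
        complex_of_real (2 * pi) * complex_of_real (Gamma (a\<^sub>1 + b\<^sub>1) * log_beta_kernel a\<^sub>1 b\<^sub>1 (x - y))"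
      using barnes_pair_inversion[OF assms(1,3), of "x - y"] unfolding P_def by simp
    finally show "(LBINT t. ?K t y) = complex_of_real (2 * pi * (Gamma (a\<^sub>1 + b\<^sub>1) * Gamma (a\<^sub>2 + b\<^sub>2)) *
      (log_beta_kernel a\<^sub>1 b\<^sub>1 (x - y) * log_beta_kernel a\<^sub>2 b\<^sub>2 y))"
      by (simp add: mult_ac)
  qed
  also have "\<dots> = complex_of_real (2 * pi) * of_real (Gamma (a\<^sub>1 + b\<^sub>1) * Gamma (a\<^sub>2 + b\<^sub>2) *
      (LBINT y. log_beta_kernel a\<^sub>1 b\<^sub>1 (x - y) * log_beta_kernel a\<^sub>2 b\<^sub>2 y))"
    unfolding integral_complex_of_real integral_mult_right_zero by (simp add: mult_ac)
  finally show ?thesis .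
qed

text \<open>
  The substitution \<open>v = e\<^sup>y\<close>, together with \<open>1 + u / v = (u + v) / v\<close>.
\<close>

lemma log_beta_kernel_convolution:
  fixes a\<^sub>1 a\<^sub>2 b\<^sub>1 b\<^sub>2 u :: real
  assumes u: "u > 0"
  shows "(LBINT y. log_beta_kernel a\<^sub>1 b\<^sub>1 (ln u - y) * log_beta_kernel a\<^sub>2 b\<^sub>2 y) =
    u powr a\<^sub>1 * (LBINT v:{0<..}. v powr (a\<^sub>2 + b\<^sub>1 - 1) * (u + v) powr (- (a\<^sub>1 + b\<^sub>1)) * (1 + v) powr (- (a\<^sub>2 + b\<^sub>2)))"
proof -
  let ?f = "\<lambda>v::real. u powr a\<^sub>1 * (v powr (a\<^sub>2 + b\<^sub>1 - 1) * (u + v) powr (- (a\<^sub>1 + b\<^sub>1)) * (1 + v) powr (- (a\<^sub>2 + b\<^sub>2)))"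
  have "log_beta_kernel a\<^sub>1 b\<^sub>1 (ln u - y) * log_beta_kernel a\<^sub>2 b\<^sub>2 y = exp y *\<^sub>R ?f (exp y)" for y
  proof -
    have "1 + exp (ln u - y) = (u + exp y) * exp (- y)"
      using u by (simp add: exp_diff exp_minus field_simps)
    hence "(1 + exp (ln u - y)) powr (- (a\<^sub>1 + b\<^sub>1)) =
        (u + exp y) powr (- (a\<^sub>1 + b\<^sub>1)) * exp (- y) powr (- (a\<^sub>1 + b\<^sub>1))"
      using u add_pos_pos[OF u exp_gt_zero[of y]] by (simp add: powr_mult)
    also have "exp (- y) powr (- (a\<^sub>1 + b\<^sub>1)) = exp ((a\<^sub>1 + b\<^sub>1) * y)"
      by (simp add: exp_powr_real algebra_simps)
    finally have "(1 + exp (ln u - y)) powr (- (a\<^sub>1 + b\<^sub>1)) =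
        (u + exp y) powr (- (a\<^sub>1 + b\<^sub>1)) * exp ((a\<^sub>1 + b\<^sub>1) * y)" .
    moreover have "exp (a\<^sub>1 * (ln u - y)) = u powr a\<^sub>1 * exp (- a\<^sub>1 * y)"
      using u by (simp add: powr_def exp_add[symmetric] algebra_simps)
    moreover have "exp (- a\<^sub>1 * y) * exp ((a\<^sub>1 + b\<^sub>1) * y) * exp (a\<^sub>2 * y) = exp y * exp y powr (a\<^sub>2 + b\<^sub>1 - 1)"
      by (simp add: exp_powr_real exp_add[symmetric] algebra_simps)
    ultimately show ?thesis unfolding log_beta_kernel_def by (simp add: mult_ac)
  qed
  hence "(LBINT y. log_beta_kernel a\<^sub>1 b\<^sub>1 (ln u - y) * log_beta_kernel a\<^sub>2 b\<^sub>2 y) = (LBINT y. exp y *\<^sub>R ?f (exp y))"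
    by simp
  also have "\<dots> = (LBINT v:{0<..}. ?f v)" by (intro lborel_integral_exp_substitution) measurable
  finally show ?thesis
    unfolding set_lebesgue_integral_def real_scaleR_def mult.left_commute[of _ "u powr a\<^sub>1"]
    by (simp only: integral_mult_right_zero)
qed

section \<open>Integrals along vertical lines\<close>

lemma eventually_both_ends_gt:
  fixes c :: real
  shows "\<forall>\<^sub>F p in at_top \<times>\<^sub>F at_top. c < fst p \<and> c < snd p"
proof (rule eventually_conj)
  show "\<forall>\<^sub>F p in at_top \<times>\<^sub>F at_top. c < fst p"
    using filterlim_fst[of at_top at_top] eventually_gt_at_top[of c] unfolding filterlim_iff by blast
  show "\<forall>\<^sub>F p in at_top \<times>\<^sub>F at_top. c < snd p"
    using filterlim_snd[of at_top at_top] eventually_gt_at_top[of c] unfolding filterlim_iff by blast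
qed

text \<open>
  An integral over \<open>[-S, T]\<close> is the integral over \<open>[-S, \<infinity>)\<close> plus that over \<open>(-\<infinity>, T]\<close> minus the total,
  which separates the two limits.
\<close>

lemma tendsto_integral_independent_ends:
  fixes g :: "real \<Rightarrow> complex"
  assumes "integrable lborel g"
  shows "((\<lambda>(S, T). integral {-S..T} g) \<longlongrightarrow> (LBINT t. g t)) (at_top \<times>\<^sub>F at_top)"
proof -
  let ?J = "LBINT t. g t"
  have [measurable]: "g \<in> borel_measurable borel" using assms by (auto dest: borel_measurable_integrable)
  have int: "integrable lborel (\<lambda>t. indicator A t *\<^sub>R g t)" if "A \<in> sets borel" for A
    using assms that by (intro integrable_mult_indicator) auto
  have up: "((\<lambda>T. LBINT t. indicator {..T} t *\<^sub>R g t) \<longlongrightarrow> ?J) at_top"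
    using assms by (intro tendsto_integral_at_top) auto
  have "((\<lambda>S. LBINT t. indicator {..S} t *\<^sub>R g (- t)) \<longlongrightarrow> (LBINT t. g (- t))) at_top"
    using assms lborel_integrable_real_affine_iff[of "-1" g 0] by (intro tendsto_integral_at_top) auto
  moreover have "(LBINT t. g (- t)) = ?J"
    using lborel_integral_real_affine[of "-1" g 0] by simp
  moreover have "(LBINT t. indicator {..S} t *\<^sub>R g (- t)) = (LBINT t. indicator {-S..} t *\<^sub>R g t)" for S
    using lborel_integral_real_affine[of "-1" "\<lambda>t. indicator {-S..} t *\<^sub>R g t" 0]
    by (simp add: indicator_def)
  ultimately have down: "((\<lambda>S. LBINT t. indicator {-S..} t *\<^sub>R g t) \<longlongrightarrow> ?J) at_top" by simp
  have "((\<lambda>p. (LBINT t. indicator {-fst p..} t *\<^sub>R g t) + (LBINT t. indicator {..snd p} t *\<^sub>R g t) - ?J) \<longlongrightarrow> ?J + ?J - ?J)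
      (at_top \<times>\<^sub>F at_top)"
    by (intro tendsto_intros filterlim_compose[OF up filterlim_snd] filterlim_compose[OF down filterlim_fst])
  moreover have "\<forall>\<^sub>F p in at_top \<times>\<^sub>F at_top.
     (LBINT t. indicator {-fst p..} t *\<^sub>R g t) + (LBINT t. indicator {..snd p} t *\<^sub>R g t) - ?J =
     (\<lambda>(S, T). integral {-S..T} g) p"
  proof -
    show ?thesis using eventually_both_ends_gt[of 0]
    proof eventually_elim
      case (elim p)
      have ind: "indicator {-fst p..snd p} t *\<^sub>R g t =
         indicator {-fst p..} t *\<^sub>R g t + indicator {..snd p} t *\<^sub>R g t - g t" for t
        using elim by (auto simp: indicator_def)
      have "integral {-fst p..snd p} g = (LBINT t:{-fst p..snd p}. g t)"
        using assms by (intro set_borel_integral_eq_integral(2)[symmetric])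
          (auto simp: set_integrable_def intro!: int)
      also have "\<dots> = (LBINT t. indicator {-fst p..} t *\<^sub>R g t) + (LBINT t. indicator {..snd p} t *\<^sub>R g t) - ?J"
        unfolding set_lebesgue_integral_def ind using int assms by simp
      finally show ?case by (simp add: case_prod_beta)
    qed
  qed
  ultimately show ?thesis by (auto elim: Lim_transform_eventually)
qed

lemma contour_integral_vertical_segment:
  assumes "continuous_on UNIV (\<lambda>t. f (Complex c t))"
    and "a < b"
  shows "(f has_contour_integral \<i> * integral {a..b} (\<lambda>t. f (Complex c t))) (linepath (Complex c a) (Complex c b))"
proof (subst has_contour_integral_linepath_same_Re_iff[of _ c _ a b])
  have "(\<lambda>t. f (Complex c t)) integrable_on {a..b}"
    using assms by (intro integrable_continuous_interval) (auto intro: continuous_on_subset)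
  thus "((\<lambda>t. f (Complex c t)) has_integral - \<i> * (\<i> * integral {a..b} (\<lambda>t. f (Complex c t)))) {a..b}"
    by (simp add: integrable_integral mult.assoc[symmetric])
qed (use assms in auto)

lemma vertical_line_integral_eq:
  assumes "continuous_on UNIV (\<lambda>t. f (Complex c t))" and "integrable lborel (\<lambda>t. f (Complex c t))"
  shows "vertical_line_integral c f = \<i> * (LBINT t. f (Complex c t))"
proof -
  have "((\<lambda>p. \<i> * (\<lambda>(S, T). integral {-S..T} (\<lambda>t. f (Complex c t))) p) \<longlongrightarrow> \<i> * (LBINT t. f (Complex c t))) (at_top \<times>\<^sub>F at_top)"
    using tendsto_integral_independent_ends[OF assms(2)] by (intro tendsto_intros)
  moreover have "\<forall>\<^sub>F p in at_top \<times>\<^sub>F at_top. \<i> * (\<lambda>(S, T). integral {-S..T} (\<lambda>t. f (Complex c t))) p =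
     (\<lambda>(S, T). contour_integral (linepath (Complex c (- S)) (Complex c T)) f) p"
    using eventually_both_ends_gt[of 0]
  proof eventually_elim
    case (elim p)
    thus ?case
      using contour_integral_unique[OF contour_integral_vertical_segment[OF assms(1), of "- fst p" "snd p"]]
      by (simp add: case_prod_beta)
  qed
  ultimately have "((\<lambda>(S, T). contour_integral (linepath (Complex c (- S)) (Complex c T)) f) \<longlongrightarrow>
      \<i> * (LBINT t. f (Complex c t))) (at_top \<times>\<^sub>F at_top)"
    by (rule Lim_transform_eventually)
  thus ?thesis unfolding vertical_line_integral_def
    by (intro tendsto_Lim) (simp_all add: prod_filter_eq_bot)
qed

text \<open>
  The residue theorem for the rectangle with vertical sides on \<open>Re s = l\<close> and \<open>Re s = r\<close> whose height
  tends to infinity; \<open>B\<close> bounds the integrand on the horizontal sides. The set \<open>S\<close> may contain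
  singularities of the wider strip that lie outside the two lines: they have winding number 0. This way
  the strip of holomorphy can be chosen freely, without first finding a gap next to the line
  \<open>Re s = l\<close>.
\<close>

lemma vertical_line_shift:
  fixes f :: "complex \<Rightarrow> complex" and l r :: real
  assumes lr: "l' < l" "l < r" "r < r'"
    and fin: "finite S"
    and hol: "f holomorphic_on {s. l' < Re s \<and> Re s < r'} - S"
    and S: "\<And>p. p \<in> S \<Longrightarrow> l' < Re p \<and> Re p < r' \<and> Re p \<noteq> l \<and> Re p \<noteq> r"
    and int_l: "integrable lborel (\<lambda>t. f (Complex l t))"
    and int_r: "integrable lborel (\<lambda>t. f (Complex r t))"
    and B: "(B \<longlongrightarrow> 0) at_top"
    and decay: "eventually (\<lambda>T. \<forall>\<sigma>\<in>{l..r}. norm (f (Complex \<sigma> T)) \<le> B T \<and> norm (f (Complex \<sigma> (-T))) \<le> B T) at_top"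
  shows "(LBINT t. f (Complex r t)) - (LBINT t. f (Complex l t)) =
           2 * of_real pi * (\<Sum>p\<in>{p\<in>S. l < Re p \<and> Re p < r}. residue f p)"
proof -
  let ?U = "{s. l' < Re s \<and> Re s < r'}"
  let ?R = "\<Sum>p\<in>{p\<in>S. l < Re p \<and> Re p < r}. residue f p"
  have U: "open ?U" "connected ?U"
  proof -
    have eq: "?U = {s. l' < Re s} \<inter> {s. Re s < r'}" by auto
    show "open ?U" unfolding eq by (intro open_Int open_halfspace_Re_gt open_halfspace_Re_lt)
    show "connected ?U" unfolding eq
      by (intro convex_connected convex_Int convex_halfspace_Re_gt convex_halfspace_Re_lt)
  qed
  have cont: "continuous_on (?U - S) f" by (rule holomorphic_on_imp_continuous_on[OF hol])
  have cont_vert: "continuous_on UNIV (\<lambda>t. f (Complex c t))" if "c = l \<or> c = r" for c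
  proof (rule continuous_on_compose2[OF cont])
    show "continuous_on UNIV (Complex c)" unfolding Complex_eq by (intro continuous_intros)
    show "range (Complex c) \<subseteq> ?U - S" using that S lr by force
  qed
  define V where "V c T = integral {-T..T} (\<lambda>t. f (Complex c t))" for c T
  define H where "H T = contour_integral (linepath (Complex l T) (Complex r T)) f" for T
  have diag: "filterlim (\<lambda>T::real. (T, T)) (at_top \<times>\<^sub>F at_top) at_top"
    by (intro filterlim_Pair filterlim_ident)
  have lim_V: "((\<lambda>T. V c T) \<longlongrightarrow> (LBINT t. f (Complex c t))) at_top" if "integrable lborel (\<lambda>t. f (Complex c t))" for c
    using filterlim_compose[OF tendsto_integral_independent_ends[OF that] diag] by (simp add: V_def)
  \<comment> \<open>Above the height \<open>M\<close> all singularities lie strictly between the horizontal sides.\<close>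
  obtain M where M: "\<And>p. p \<in> S \<Longrightarrow> \<bar>Im p\<bar> \<le> M"
  proof -
    have "bounded (Im ` S)" using fin by (intro finite_imp_bounded) auto
    thus ?thesis using that by (auto simp: bounded_iff)
  qed
  have horiz: "f contour_integrable_on linepath (Complex \<sigma> T) (Complex \<sigma>' T)"
    if "\<bar>T\<bar> > M" "\<sigma> \<in> {l..r}" "\<sigma>' \<in> {l..r}" for T \<sigma> \<sigma>'
  proof (rule contour_integrable_continuous_linepath, rule continuous_on_subset[OF cont])
    show "closed_segment (Complex \<sigma> T) (Complex \<sigma>' T) \<subseteq> ?U - S"
    proof
      fix z assume "z \<in> closed_segment (Complex \<sigma> T) (Complex \<sigma>' T)"
      hence "Im z = T" "Re z \<in> closed_segment \<sigma> \<sigma>'"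
        by (auto simp: closed_segment_same_Im)
      moreover from this(2) that have "Re z \<in> {l..r}"
        by (auto simp: closed_segment_eq_real_ivl split: if_splits)
      ultimately show "z \<in> ?U - S" using that lr M[of z] by force
    qed
  qed
  have rect: "eventually (\<lambda>T. H (-T) + \<i> * V r T - H T - \<i> * V l T = 2 * of_real pi * \<i> * ?R) at_top"
    using eventually_gt_at_top[of M] eventually_gt_at_top[of 0]
  proof eventually_elim
    case (elim T)
    let ?a = "Complex l (-T)" and ?c = "Complex r T"
    let ?b = "Complex r (-T)" and ?d = "Complex l T"
    have path_sub: "path_image (rectpath ?a ?c) \<subseteq> ?U - S"
      using elim lr S M by (fastforce simp: path_image_rectpath)
    have "contour_integral (rectpath ?a ?c) f =
        2 * pi * \<i> * (\<Sum>p\<in>S. winding_number (rectpath ?a ?c) p * residue f p)"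
    proof (rule Residue_theorem[OF U fin hol])
      show "\<forall>z. z \<notin> ?U \<longrightarrow> winding_number (rectpath ?a ?c) z = 0"
        using lr elim by (auto intro!: winding_number_rectpath_outside simp: in_cbox_complex_iff)
    qed (use path_sub in auto)
    also have "(\<Sum>p\<in>S. winding_number (rectpath ?a ?c) p * residue f p) =
       (\<Sum>p\<in>S. if l < Re p \<and> Re p < r then residue f p else 0)"
    proof (rule sum.cong[OF refl])
      fix p assume p: "p \<in> S"
      show "winding_number (rectpath ?a ?c) p * residue f p =
          (if l < Re p \<and> Re p < r then residue f p else 0)"
      proof (cases "l < Re p \<and> Re p < r")
        case True
        hence "p \<in> box ?a ?c" using M[OF p] elim by (auto simp: in_box_complex_iff)
        thus ?thesis using True by (simp add: winding_number_rectpath)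
      next
        case False
        hence "p \<notin> cbox ?a ?c" using S[OF p] by (auto simp: in_cbox_complex_iff)
        hence "winding_number (rectpath ?a ?c) p = 0"
          using lr elim by (intro winding_number_rectpath_outside) auto
        thus ?thesis using False by auto
      qed
    qed
    also have "\<dots> = ?R" using fin by (simp add: sum.inter_filter)
    finally have 1: "contour_integral (rectpath ?a ?c) f = 2 * of_real pi * \<i> * ?R" by simp
    have i1: "f contour_integrable_on linepath ?a ?b" "f contour_integrable_on linepath ?c ?d"
      "f contour_integrable_on linepath ?d ?c"
      using elim lr by (auto intro!: horiz)
    have vert: "(f has_contour_integral \<i> * V c T) (linepath (Complex c (-T)) (Complex c T))" if "c = l \<or> c = r" for c
      unfolding V_def using elim by (intro contour_integral_vertical_segment cont_vert that) auto
    have i2: "f contour_integrable_on linepath ?b ?c" "f contour_integrable_on linepath ?a ?d"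
      using vert[of r] vert[of l] by (auto simp: contour_integrable_on_def)
    have i3: "(f has_contour_integral - (\<i> * V l T)) (linepath ?d ?a)"
      using has_contour_integral_reversepath[OF _ vert[of l]] by simp
    have h2: "contour_integral (linepath ?c ?d) f = - H T"
      using contour_integral_reversepath[of "linepath ?d ?c" f] by (simp add: H_def)
    have "contour_integral (rectpath ?a ?c) f =
        contour_integral (linepath ?a ?b) f + contour_integral (linepath ?b ?c) f +
        contour_integral (linepath ?c ?d) f + contour_integral (linepath ?d ?a) f"
      using i1 i2 i3 unfolding rectpath_def Let_def
      by (auto simp: contour_integral_join contour_integrable_join has_contour_integral_integrable add.assoc)
    also have "\<dots> = H (-T) + \<i> * V r T - H T - \<i> * V l T"
      using contour_integral_unique[OF vert[of r]] contour_integral_unique[OF i3] h2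
      by (simp add: H_def)
    finally show ?case using 1 by simp
  qed
  have H_bound: "eventually (\<lambda>T. norm (H T) \<le> B T * (r - l) \<and> norm (H (-T)) \<le> B T * (r - l)) at_top"
    using decay eventually_gt_at_top[of "\<bar>M\<bar>"]
  proof eventually_elim
    case (elim T)
    have "norm (H \<tau>) \<le> B T * norm (Complex r \<tau> - Complex l \<tau>)"
      if "\<tau> = T \<or> \<tau> = - T" for \<tau>
      unfolding H_def
    proof (rule contour_integral_bound_linepath)
      show "f contour_integrable_on linepath (Complex l \<tau>) (Complex r \<tau>)"
        using elim that lr by (intro horiz) auto
      have "norm (f (Complex l T)) \<le> B T" using elim lr by auto
      thus "0 \<le> B T" using norm_ge_zero order_trans by blast
      fix z assume "z \<in> closed_segment (Complex l \<tau>) (Complex r \<tau>)"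
      hence "Im z = \<tau>" "Re z \<in> closed_segment l r" by (auto simp: closed_segment_same_Im)
      moreover from this(2) have "Re z \<in> {l..r}" using lr by (simp add: closed_segment_eq_real_ivl)
      moreover have "z = Complex (Re z) (Im z)" by simp
      ultimately show "norm (f z) \<le> B T" using elim(1) that by metis
    qed
    moreover have "norm (Complex r \<tau> - Complex l \<tau>) = r - l" for \<tau>
      using lr by (simp add: cmod_def)
    ultimately show ?case by simp
  qed
  have B': "((\<lambda>T. B T * (r - l)) \<longlongrightarrow> 0) at_top" using B by (auto intro!: tendsto_eq_intros)
  have H0: "(H \<longlongrightarrow> 0) at_top" "((\<lambda>T. H (-T)) \<longlongrightarrow> 0) at_top"
    using H_bound by (auto intro!: Lim_null_comparison[OF _ B'] elim: eventually_mono)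
  have "((\<lambda>T. H (-T) + \<i> * V r T - H T - \<i> * V l T) \<longlongrightarrow>
     0 + \<i> * (LBINT t. f (Complex r t)) - 0 - \<i> * (LBINT t. f (Complex l t))) at_top"
    by (intro tendsto_intros H0 lim_V int_l int_r)
  moreover from rect have "((\<lambda>T. H (-T) + \<i> * V r T - H T - \<i> * V l T) \<longlongrightarrow> 2 * of_real pi * \<i> * ?R) at_top"
    by (rule tendsto_eventually)
  ultimately have "0 + \<i> * (LBINT t. f (Complex r t)) - 0 - \<i> * (LBINT t. f (Complex l t)) = 2 * of_real pi * \<i> * ?R"
    by (intro tendsto_unique) auto
  hence "\<i> * ((LBINT t. f (Complex r t)) - (LBINT t. f (Complex l t))) = \<i> * (2 * of_real pi * ?R)"
    by (simp add: algebra_simps)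
  thus ?thesis by (simp only: mult_cancel_left complex_i_not_zero simp_thms)
qed

section \<open>Evaluation by residues\<close>

lemma Gamma_minus_nat:
  fixes z :: complex
  assumes "z \<notin> \<int>"
  shows "Gamma (z - of_nat k) = (-1) ^ k * Gamma z / pochhammer (1 - z) k"
proof -
  have nz: "z - of_nat k \<notin> \<int>\<^sub>\<le>\<^sub>0"
    using assms by (metis Ints_add Ints_of_nat diff_add_cancel nonpos_Ints_Int)
  have nG: "Gamma (z - of_nat k) \<noteq> 0" using nz by (simp add: Gamma_eq_zero_iff)
  have "pochhammer (z - of_nat k) k = Gamma z / Gamma (z - of_nat k)"
    using pochhammer_Gamma[OF nz, of k] by simp
  hence 1: "Gamma (z - of_nat k) * pochhammer (z - of_nat k) k = Gamma z" using nG by simp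
  have "pochhammer (z - of_nat k) k = (-1) ^ k * pochhammer (1 - z) k"
    using pochhammer_minus'[of "- (z - of_nat k)" k] pochhammer_minus[of "- (z - of_nat k)" k] by (simp add: algebra_simps)
  with 1 have 2: "Gamma (z - of_nat k) * ((-1) ^ k * pochhammer (1 - z) k) = Gamma z" by simp
  have pz: "pochhammer (1 - z) k \<noteq> 0"
  proof
    assume "pochhammer (1 - z) k = 0"
    then obtain m where "1 - z = - of_nat m" by (auto simp: pochhammer_eq_0_iff)
    hence "z = 1 + of_nat m" by (simp add: algebra_simps)
    thus False using assms by auto
  qed
  have "(-1) ^ k * Gamma z = ((-1) ^ k * (-1) ^ k) * (Gamma (z - of_nat k) * pochhammer (1 - z) k)"
    unfolding 2[symmetric] by (simp only: mult_ac)
  also have "(-1) ^ k * (-1) ^ k = (1::complex)" by (simp flip: power_mult_distrib)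
  finally show ?thesis using pz by (simp add: field_simps)
qed

text \<open>
  Dividing by a Pochhammer symbol brings the argument into the right half plane, where
  \<open>|\<Gamma>(z)| \<le> \<Gamma>(Re z)\<close>; each factor of the Pochhammer symbol has modulus at least \<open>|T|\<close>, and at least
  one factor is present.
\<close>

lemma Gamma_horizontal_decay:
  fixes a l r :: real
  shows "\<exists>C. \<forall>T \<sigma>. \<bar>T\<bar> \<ge> 1 \<longrightarrow> \<sigma> \<in> {l..r} \<longrightarrow> norm (Gamma (a + Complex \<sigma> T)) \<le> C / \<bar>T\<bar>"
proof -
  obtain m :: nat where m: "m > - (a + l)" using reals_Archimedean2 by blast
  define M where "M = Suc m"
  have M: "a + l + M > 0" using m by (simp add: M_def)
  have "compact ((\<lambda>x. Gamma x) ` {a + l + M..a + r + M})"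
    using M by (intro compact_continuous_image continuous_on_Gamma compact_Icc) (auto elim!: nonpos_Ints_cases)
  then obtain C where C: "\<forall>x\<in>{a + l + M..a + r + M}. \<bar>Gamma x\<bar> \<le> C"
    by (auto dest!: compact_imp_bounded simp: bounded_iff)
  have "norm (Gamma (a + Complex \<sigma> T)) \<le> C / \<bar>T\<bar>" if T: "\<bar>T\<bar> \<ge> 1" and \<sigma>: "\<sigma> \<in> {l..r}" for T \<sigma>
  proof -
    let ?z = "a + Complex \<sigma> T"
    have "?z \<notin> \<int>\<^sub>\<le>\<^sub>0" using T by (auto elim!: nonpos_Ints_cases simp: complex_eq_iff)
    hence eq: "Gamma (?z + of_nat M) = pochhammer ?z M * Gamma ?z"
      using pochhammer_Gamma[of ?z M] by (simp add: Gamma_eq_zero_iff)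
    have "norm (?z + of_nat k) \<ge> \<bar>T\<bar>" for k using abs_Im_le_cmod[of "?z + of_nat k"] by simp
    hence "(\<Prod>k<M. \<bar>T\<bar>) \<le> (\<Prod>k<M. norm (?z + of_nat k))" by (intro prod_mono) auto
    also have "\<dots> = norm (pochhammer ?z M)" by (simp add: pochhammer_prod prod_norm atLeast0LessThan)
    finally have "\<bar>T\<bar> ^ M \<le> norm (pochhammer ?z M)" by simp
    moreover have "\<bar>T\<bar> ^ 1 \<le> \<bar>T\<bar> ^ M" using T by (intro power_increasing) (auto simp: M_def)
    ultimately have "\<bar>T\<bar> * norm (Gamma ?z) \<le> norm (pochhammer ?z M) * norm (Gamma ?z)"
      by (intro mult_right_mono) auto
    also have "\<dots> = norm (Gamma (?z + of_nat M))" by (simp add: eq norm_mult)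
    also have "\<dots> \<le> Gamma (Re (?z + of_nat M))"
      using M \<sigma> by (intro norm_Gamma_le_Re) auto
    also have "\<dots> \<le> C" using bspec[OF C, of "a + \<sigma> + M"] \<sigma> by simp
    finally show ?thesis using T by (simp add: field_simps)
  qed
  thus ?thesis by blast
qed

text \<open>
  Moving the pair one unit to the left multiplies it by a quotient
  \<open>(q + k - \<i> t) / (p - 1 - k + \<i> t)\<close>. A common imaginary part moves a quotient of moduli towards 1,
  so this one has modulus at most the maximum of 1 and the quotient of the real parts, a bound
  independent of \<open>t\<close>. That \<open>p\<close> is no integer keeps the shifted lines away from the poles.
\<close>

lemma norm_Gamma_pair_shift_left:
  fixes p q t :: real
  assumes p: "p > 0" "p \<notin> \<int>" and q: "q > 0"
  shows "norm (Gamma (p + \<i> * t - of_nat N) * Gamma (q - \<i> * t + of_nat N)) \<le>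
    (\<Prod>k<N. max 1 ((q + real k) / \<bar>p - 1 - real k\<bar>)) * norm (Gamma (p + \<i> * t) * Gamma (q - \<i> * t))"
proof (induction N)
  case (Suc N)
  let ?z = "p + \<i> * t - of_nat (Suc N)" and ?w = "q - \<i> * t + of_nat N"
  \<comment> \<open>Otherwise the bound would involve a division by 0, whose value 0 would make it false.\<close>
  have pk: "p - 1 - N \<noteq> 0"
  proof
    assume "p - 1 - N = 0"
    hence "p = of_nat (Suc N)" by simp
    thus False using p(2) Ints_of_nat by metis
  qed
  have z: "?z \<notin> \<int>\<^sub>\<le>\<^sub>0"
  proof
    assume "?z \<in> \<int>\<^sub>\<le>\<^sub>0"
    then obtain n where "?z = of_int n" by (auto elim!: nonpos_Ints_cases)
    hence "p - of_nat (Suc N) = of_int n" by (auto simp: complex_eq_iff)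
    hence "p = of_int (n + int (Suc N))" by simp
    thus False using p(2) Ints_of_int by metis
  qed
  have w: "?w \<notin> \<int>\<^sub>\<le>\<^sub>0" using q by (intro not_nonpos_Int_if_Re_pos) auto
  have z0: "?z \<noteq> 0" using z by auto
  have G1: "Gamma (p + \<i> * t - of_nat N) = ?z * Gamma ?z"
    using Gamma_plus1[OF z] by (simp add: algebra_simps)
  have G2: "Gamma (q - \<i> * t + of_nat (Suc N)) = ?w * Gamma ?w"
    using Gamma_plus1[OF w] by (simp add: algebra_simps)
  have ratio: "norm ?w \<le> max 1 ((q + N) / \<bar>p - 1 - N\<bar>) * norm ?z"
  proof -
    let ?m = "max 1 ((q + N) / \<bar>p - 1 - N\<bar>)"
    have "q + N \<le> ?m * \<bar>p - 1 - N\<bar>" using pk by (simp add: pos_divide_le_eq[symmetric])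
    hence "(q + N)\<^sup>2 \<le> (?m * \<bar>p - 1 - N\<bar>)\<^sup>2" using q by (intro power_mono) auto
    moreover have "1 * t\<^sup>2 \<le> ?m\<^sup>2 * t\<^sup>2" by (intro mult_right_mono one_le_power) auto
    ultimately have "(q + N)\<^sup>2 + t\<^sup>2 \<le> ?m\<^sup>2 * ((p - 1 - N)\<^sup>2 + t\<^sup>2)"
      by (simp add: power_mult_distrib ring_distribs)
    hence "sqrt ((q + N)\<^sup>2 + t\<^sup>2) \<le> sqrt (?m\<^sup>2 * ((p - 1 - N)\<^sup>2 + t\<^sup>2))" by (rule real_sqrt_le_mono)
    also have "\<dots> = ?m * sqrt ((p - 1 - N)\<^sup>2 + t\<^sup>2)" by (simp add: real_sqrt_mult)
    finally show ?thesis by (simp add: cmod_def algebra_simps)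
  qed
  have "norm (Gamma ?z * Gamma (q - \<i> * t + of_nat (Suc N))) =
      norm ?w * (norm (Gamma ?z) * norm (Gamma ?w))" unfolding G2 norm_mult by (simp only: mult_ac)
  also have "\<dots> \<le> (max 1 ((q + N) / \<bar>p - 1 - N\<bar>) * norm ?z) * (norm (Gamma ?z) * norm (Gamma ?w))"
    by (intro mult_right_mono ratio) auto
  also have "\<dots> = max 1 ((q + N) / \<bar>p - 1 - N\<bar>) * norm (Gamma (p + \<i> * t - of_nat N) * Gamma ?w)"
    unfolding G1 norm_mult by (simp only: mult_ac)
  also have "\<dots> \<le> max 1 ((q + N) / \<bar>p - 1 - N\<bar>) * 
     ((\<Prod>k<N. max 1 ((q + real k) / \<bar>p - 1 - real k\<bar>)) * norm (Gamma (p + \<i> * t) * Gamma (q - \<i> * t)))"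
    using Suc.IH by (rule mult_left_mono) simp
  finally show ?case by (simp add: mult_ac)
qed simp

lemma prod_tendsto_0_if_ratio_lt_1:
  fixes f :: "nat \<Rightarrow> real"
  assumes "f \<longlonglongrightarrow> c" "c < 1" "\<And>n. f n \<ge> 0"
  shows "(\<lambda>n. \<Prod>k<n. f k) \<longlonglongrightarrow> 0"
proof -
  obtain d where d: "c < d" "d < 1" using assms(2) dense by blast
  from assms(1) d have "eventually (\<lambda>n. f n < d) sequentially" by (intro order_tendstoD)
  then obtain N where N: "\<And>n. n \<ge> N \<Longrightarrow> f n < d" by (auto simp: eventually_sequentially)
  have "summable (\<lambda>n. \<Prod>k<n. f k)"
  proof (rule summable_ratio_test[OF d(2)])
    fix n assume "N \<le> n"
    have nn: "(\<Prod>k<n. f k) \<ge> 0" by (intro prod_nonneg) (simp add: assms)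
    have "(\<Prod>k<n. f k) * f n \<le> (\<Prod>k<n. f k) * d"
      using N[OF \<open>N \<le> n\<close>] nn by (intro mult_left_mono) auto
    thus "norm (\<Prod>k<Suc n. f k) \<le> d * norm (\<Prod>k<n. f k)"
      using nn assms(3)[of n] by (simp add: mult.commute abs_mult)
  qed
  thus ?thesis by (rule summable_LIMSEQ_zero)
qed

lemma tendsto_pair_shift_ratio:
  fixes p q :: real
  shows "(\<lambda>k. max 1 ((q + real k) / \<bar>p - 1 - real k\<bar>)) \<longlonglongrightarrow> 1"
proof -
  have "(\<lambda>k. (q + real k) / \<bar>p - 1 - real k\<bar>) \<longlonglongrightarrow> 1"
  proof (rule Lim_transform_eventually)
    show "(\<lambda>k. (q + real k) / (real k + 1 - p)) \<longlonglongrightarrow> 1" by real_asymp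
    have "eventually (\<lambda>k. real k > p) sequentially" by real_asymp
    thus "eventually (\<lambda>k. (q + real k) / (real k + 1 - p) = (q + real k) / \<bar>p - 1 - real k\<bar>) sequentially"
      by eventually_elim (auto simp: abs_if)
  qed
  from tendsto_max[OF tendsto_const[of 1] this] show ?thesis by simp
qed

lemma summable_hypergeo:
  fixes A B c u :: real
  assumes "\<bar>u\<bar> < 1" "A > 0" "B > 0" "\<And>k::nat. c + k \<noteq> 0"
  shows "summable (\<lambda>k. fps_nth (fps_hypergeo [A, B] [c] 1) k * u ^ k)"
proof -
  let ?h = "fps_nth (fps_hypergeo [A, B] [c] 1)"
  obtain d where d: "\<bar>u\<bar> < d" "d < 1" using assms(1) dense by blast
  have "(\<lambda>n. \<bar>(A + real n) * (B + real n) / ((real n + 1) * (c + real n))\<bar> * \<bar>u\<bar>) \<longlonglongrightarrow> \<bar>1\<bar> * \<bar>u\<bar>"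
    by (intro tendsto_intros tendsto_rabs) real_asymp
  with d have "eventually (\<lambda>n. \<bar>(A + real n) * (B + real n) / ((real n + 1) * (c + real n))\<bar> * \<bar>u\<bar> < d) sequentially"
    by (intro order_tendstoD) auto
  then obtain N where N: "\<And>n. n \<ge> N \<Longrightarrow> \<bar>(A + real n) * (B + real n) / ((real n + 1) * (c + real n))\<bar> * \<bar>u\<bar> < d"
    by (auto simp: eventually_sequentially)
  show ?thesis
  proof (rule summable_ratio_test[OF d(2)])
    fix n assume n: "N \<le> n"
    have "norm (?h (Suc n) * u ^ Suc n) =
       (\<bar>(A + real n) * (B + real n) / ((real n + 1) * (c + real n))\<bar> * \<bar>u\<bar>) * norm (?h n * u ^ n)"
      unfolding fps_hypergeo_rec by (simp add: abs_mult add.commute)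
    also have "\<dots> \<le> d * norm (?h n * u ^ n)"
      using N[OF n] by (intro mult_right_mono) auto
    finally show "norm (?h (Suc n) * u ^ Suc n) \<le> d * norm (?h n * u ^ n)" .
  qed
qed

lemma barnes_integrand_commute: "barnes_integrand a\<^sub>1 a\<^sub>2 b\<^sub>1 b\<^sub>2 = barnes_integrand a\<^sub>2 a\<^sub>1 b\<^sub>1 b\<^sub>2"
  by (simp add: fun_eq_iff barnes_integrand_def mult_ac)

lemma open_vimage_Compl_integers:
  fixes h :: "complex \<Rightarrow> complex"
  assumes "continuous_on UNIV h" "A \<subseteq> \<int>"
  shows "open {s. h s \<notin> A}"
proof -
  have "open (h -` (- A))"
    using assms by (intro open_vimage) (auto intro: closed_subset_Ints)
  also have "h -` (- A) = {s. h s \<notin> A}" by auto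
  finally show ?thesis .
qed

text \<open>
  Of the four Gamma functions only \<open>\<Gamma>(a\<^sub>1 + s)\<close> is singular at \<open>- a\<^sub>1 - k\<close>, with residue
  \<open>(-1)\<^sup>k / k!\<close>. The values of the other three differ from their values for \<open>k = 0\<close> by Pochhammer symbols; the
  sign \<open>(-1)\<^sup>k\<close> from \<open>\<Gamma>(a\<^sub>2 - a\<^sub>1 - k)\<close> cancels the one in the residue, which leaves a term of a
  hypergeometric series.
\<close>

lemma residue_barnes:
  fixes a\<^sub>1 a\<^sub>2 b\<^sub>1 b\<^sub>2 x :: real
  assumes ab: "a\<^sub>1 + b\<^sub>1 > 0" "a\<^sub>1 + b\<^sub>2 > 0" and noint: "a\<^sub>2 - a\<^sub>1 \<notin> \<int>"
  shows "residue (\<lambda>s. barnes_integrand a\<^sub>1 a\<^sub>2 b\<^sub>1 b\<^sub>2 s * exp (- (s * x))) (of_real (- a\<^sub>1 - real k)) =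
    of_real (Gamma (a\<^sub>2 - a\<^sub>1) * Gamma (a\<^sub>1 + b\<^sub>1) * Gamma (a\<^sub>1 + b\<^sub>2) * exp (a\<^sub>1 * x) *
      (fps_nth (fps_hypergeo [a\<^sub>1 + b\<^sub>1, a\<^sub>1 + b\<^sub>2] [1 + a\<^sub>1 - a\<^sub>2] 1) k * exp x ^ k))"
proof -
  let ?p = "complex_of_real (- a\<^sub>1 - real k)"
  let ?g = "\<lambda>s. Gamma (complex_of_real a\<^sub>2 + s) * Gamma (complex_of_real b\<^sub>1 - s) *
    Gamma (complex_of_real b\<^sub>2 - s) * exp (- (s * complex_of_real x))"
  define V where "V = {s. complex_of_real a\<^sub>1 + s \<notin> \<int>\<^sub>\<le>\<^sub>0 - {- of_nat k}} \<inter>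
     {s. complex_of_real a\<^sub>2 + s \<notin> \<int>\<^sub>\<le>\<^sub>0} \<inter>
     {s. complex_of_real b\<^sub>1 - s \<notin> \<int>\<^sub>\<le>\<^sub>0} \<inter> {s. complex_of_real b\<^sub>2 - s \<notin> \<int>\<^sub>\<le>\<^sub>0}"
  have "open V" unfolding V_def
    by (intro open_Int open_vimage_Compl_integers continuous_intros) auto
  have noint': "complex_of_real a\<^sub>2 - complex_of_real a\<^sub>1 \<notin> \<int>"
  proof
    assume "complex_of_real a\<^sub>2 - complex_of_real a\<^sub>1 \<in> \<int>"
    then obtain n where "complex_of_real a\<^sub>2 - complex_of_real a\<^sub>1 = of_int n" by (auto elim: Ints_cases)
    hence "a\<^sub>2 - a\<^sub>1 = of_int n" by (simp add: complex_eq_iff)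
    with noint show False by auto
  qed
  have bp: "complex_of_real b - ?p = complex_of_real (a\<^sub>1 + b) + of_nat k" for b by simp
  have ap: "complex_of_real a\<^sub>2 + ?p = complex_of_real a\<^sub>2 - complex_of_real a\<^sub>1 - of_nat k" by simp
  have a2p: "complex_of_real a\<^sub>2 + ?p \<notin> \<int>\<^sub>\<le>\<^sub>0"
    unfolding ap using noint' by (metis Ints_add Ints_of_nat diff_add_cancel nonpos_Ints_Int)
  have bpp: "complex_of_real b - ?p \<notin> \<int>\<^sub>\<le>\<^sub>0" if "a\<^sub>1 + b > 0" for b
    unfolding bp using that by (intro not_nonpos_Int_if_Re_pos) auto
  have Gb: "Gamma (complex_of_real b - ?p) = of_real (Gamma (a\<^sub>1 + b) * pochhammer (a\<^sub>1 + b) k)"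
    if "a\<^sub>1 + b > 0" for b
  proof -
    have "Gamma (a\<^sub>1 + b) > 0" using that by (intro Gamma_real_pos)
    moreover have "a\<^sub>1 + b \<notin> \<int>\<^sub>\<le>\<^sub>0" using that by (auto elim!: nonpos_Ints_cases)
    ultimately have "Gamma (a\<^sub>1 + b + real k) = Gamma (a\<^sub>1 + b) * pochhammer (a\<^sub>1 + b) k"
      by (simp add: pochhammer_Gamma)
    moreover have "complex_of_real b - ?p = of_real (a\<^sub>1 + b + real k)" by simp
    ultimately show ?thesis by (simp only: Gamma_complex_of_real)
  qed
  have pV: "?p \<in> V" unfolding V_def using a2p bpp ab by auto
  have hol: "(\<lambda>s. barnes_integrand a\<^sub>1 a\<^sub>2 b\<^sub>1 b\<^sub>2 s * exp (- (s * x))) holomorphic_on V - {?p}"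
    unfolding barnes_integrand_def
  proof (intro holomorphic_intros)
    fix s assume s: "s \<in> V - {?p}"
    have "complex_of_real a\<^sub>1 + s \<noteq> - of_nat k" using s by (auto simp: complex_eq_iff)
    thus "complex_of_real a\<^sub>1 + s \<notin> \<int>\<^sub>\<le>\<^sub>0" using s by (auto simp: V_def)
  qed (auto simp: V_def)
  have cont: "isCont ?g ?p"
    by (intro continuous_intros isCont_o2[OF _ isCont_Gamma, of ?p] a2p bpp ab)
  have "filterlim (\<lambda>s. complex_of_real a\<^sub>1 + s) (at (- of_nat k)) (at ?p)"
    unfolding filterlim_at
  proof
    have "((\<lambda>s. complex_of_real a\<^sub>1 + s) \<longlongrightarrow> complex_of_real a\<^sub>1 + ?p) (at ?p)" by (intro tendsto_intros)
    thus "((\<lambda>s. complex_of_real a\<^sub>1 + s) \<longlongrightarrow> - of_nat k) (at ?p)" by simp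
    show "\<forall>\<^sub>F s in at ?p. complex_of_real a\<^sub>1 + s \<in> UNIV \<and> complex_of_real a\<^sub>1 + s \<noteq> - of_nat k"
      by (auto simp: eventually_at_filter complex_eq_iff intro!: always_eventually)
  qed
  from filterlim_compose[OF Gamma_residues[of k] this]
  have "((\<lambda>s. Gamma (complex_of_real a\<^sub>1 + s) * (s - ?p)) \<longlongrightarrow> (-1) ^ k / fact k) (at ?p)" by (simp add: algebra_simps)
  from tendsto_mult[OF this cont[unfolded isCont_def]]
  have lim: "((\<lambda>s. barnes_integrand a\<^sub>1 a\<^sub>2 b\<^sub>1 b\<^sub>2 s * exp (- (s * x)) * (s - ?p)) \<longlongrightarrow> (-1) ^ k / fact k * ?g ?p) (at ?p)"
    by (simp add: barnes_integrand_def mult_ac)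
  have "residue (\<lambda>s. barnes_integrand a\<^sub>1 a\<^sub>2 b\<^sub>1 b\<^sub>2 s * exp (- (s * x))) ?p = (-1) ^ k / fact k * ?g ?p"
    by (rule residue_simple'[OF \<open>open V\<close> pV hol lim])
  also have "Gamma (complex_of_real a\<^sub>2 + ?p) = 
      (-1) ^ k * of_real (Gamma (a\<^sub>2 - a\<^sub>1) / pochhammer (1 + a\<^sub>1 - a\<^sub>2) k)"
  proof -
    have e1: "1 - (complex_of_real a\<^sub>2 - complex_of_real a\<^sub>1) = of_real (1 + a\<^sub>1 - a\<^sub>2)"
      and e2: "complex_of_real a\<^sub>2 - complex_of_real a\<^sub>1 = of_real (a\<^sub>2 - a\<^sub>1)" by simp_all
    show ?thesis
      unfolding ap Gamma_minus_nat[OF noint'] e1 unfolding e2 Gamma_complex_of_real pochhammer_of_real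
      by simp
  qed
  also have "Gamma (complex_of_real b\<^sub>1 - ?p) = of_real (Gamma (a\<^sub>1 + b\<^sub>1) * pochhammer (a\<^sub>1 + b\<^sub>1) k)"
    by (rule Gb[OF ab(1)])
  also have "Gamma (complex_of_real b\<^sub>2 - ?p) = of_real (Gamma (a\<^sub>1 + b\<^sub>2) * pochhammer (a\<^sub>1 + b\<^sub>2) k)"
    by (rule Gb[OF ab(2)])
  also have "exp (- (?p * of_real x)) = of_real (exp (a\<^sub>1 * x) * exp x ^ k)"
    by (simp add: exp_of_nat_mult[symmetric] exp_add[symmetric] exp_of_real[symmetric] algebra_simps)
  also have "(-1) ^ k / fact k * ((-1) ^ k * of_real (Gamma (a\<^sub>2 - a\<^sub>1) / pochhammer (1 + a\<^sub>1 - a\<^sub>2) k) *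
       of_real (Gamma (a\<^sub>1 + b\<^sub>1) * pochhammer (a\<^sub>1 + b\<^sub>1) k) *
       of_real (Gamma (a\<^sub>1 + b\<^sub>2) * pochhammer (a\<^sub>1 + b\<^sub>2) k) * of_real (exp (a\<^sub>1 * x) * exp x ^ k)) =
     ((-1) ^ k * (-1) ^ k) * complex_of_real (Gamma (a\<^sub>2 - a\<^sub>1) * Gamma (a\<^sub>1 + b\<^sub>1) * Gamma (a\<^sub>1 + b\<^sub>2) * exp (a\<^sub>1 * x) *
      (fps_nth (fps_hypergeo [a\<^sub>1 + b\<^sub>1, a\<^sub>1 + b\<^sub>2] [1 + a\<^sub>1 - a\<^sub>2] 1) k * exp x ^ k))"
    by (simp add: field_simps)
  also have "(-1) ^ k * (-1) ^ k = (1::complex)" by (simp flip: power_mult_distrib)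
  finally show ?thesis by simp
qed

text \<open>
  The lines \<open>Re s = d - N\<close> used for the shift must avoid all poles at once. This excludes countably many
  \<open>d\<close> from an interval.
\<close>

lemma ex_shift_off_integers:
  fixes a\<^sub>1 a\<^sub>2 :: real
  assumes "a\<^sub>1 > 0" "a\<^sub>2 > 0"
  obtains d where "d < 0" "a\<^sub>1 + d > 0" "a\<^sub>2 + d > 0" "a\<^sub>1 + d \<notin> \<int>" "a\<^sub>2 + d \<notin> \<int>"
proof -
  \<comment> \<open>The values of \<open>d\<close> for which some \<open>a\<^sub>j + d\<close> is an integer.\<close>
  let ?C = "(\<lambda>n. n - a\<^sub>1) ` \<int> \<union> (\<lambda>n. n - a\<^sub>2) ` \<int>"
  have "countable ?C" by (intro countable_Un countable_image countable_int) 
  moreover have "uncountable {max (- a\<^sub>1) (- a\<^sub>2)<..<0}"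
    using assms by (subst uncountable_open_interval) auto
  ultimately have "\<not> {max (- a\<^sub>1) (- a\<^sub>2)<..<0} \<subseteq> ?C" using countable_subset by blast
  then obtain d where "d \<in> {max (- a\<^sub>1) (- a\<^sub>2)<..<0}" "d \<notin> ?C" by blast
  hence d: "- a\<^sub>1 < d" "- a\<^sub>2 < d" "d < 0" "d \<notin> (\<lambda>n. n - a\<^sub>1) ` \<int>" "d \<notin> (\<lambda>n. n - a\<^sub>2) ` \<int>" by auto
  have "a + d \<notin> \<int>" if "d \<notin> (\<lambda>n. n - a) ` \<int>" for a
  proof
    assume "a + d \<in> \<int>"
    moreover have "d = (a + d) - a" by simp
    ultimately show False using that by blast
  qed
  with d show ?thesis by (intro that[of d]) auto
qed

lemma tendsto_sum_below:
  fixes r :: "nat \<Rightarrow> complex" and p :: real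
  assumes "summable r"
  shows "(\<lambda>N::nat. \<Sum>k\<in>{k. p + real k < real N}. r k) \<longlonglongrightarrow> (\<Sum>k. r k)"
proof -
  have eq: "{k. p + real k < real N} = {..<nat \<lceil>real N - p\<rceil>}" for N
    by (auto simp: zless_nat_eq_int_zless less_ceiling_iff)
  have "filterlim (\<lambda>N. nat \<lceil>real N - p\<rceil>) at_top sequentially"
    unfolding filterlim_at_top
  proof
    fix Z :: nat
    have "\<forall>\<^sub>F N in sequentially. real N > p + Z" by real_asymp
    thus "\<forall>\<^sub>F N in sequentially. Z \<le> nat \<lceil>real N - p\<rceil>"
      by eventually_elim linarith
  qed
  from filterlim_compose[OF summable_LIMSEQ[OF assms] this] show ?thesis unfolding eq .
qed

text \<open>
  The line \<open>Re s = 0\<close> is moved to \<open>Re s = d - N\<close>. The poles crossed are \<open>- a\<^sub>j - k\<close> with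
  \<open>a\<^sub>j + d + k < N\<close>, so their residues are partial sums of the two series. The integral over the
  new line is at most a constant times \<open>u\<^sup>N\<close> times a product of \<open>2 N\<close> factors tending to 1; since \<open>u < 1\<close>,
  this tends to 0.
\<close>

theorem barnes_integral_eq_hypergeo:
  fixes a\<^sub>1 a\<^sub>2 b\<^sub>1 b\<^sub>2 u :: real
  assumes pos: "a\<^sub>1 > 0" "a\<^sub>2 > 0" "b\<^sub>1 > 0" "b\<^sub>2 > 0" and noint: "a\<^sub>1 - a\<^sub>2 \<notin> \<int>"
    and u: "0 < u" "u < 1"
  shows "(LBINT t. barnes_integrand a\<^sub>1 a\<^sub>2 b\<^sub>1 b\<^sub>2 (\<i> * t) * exp (- (\<i> * of_real (ln u * t)))) =
    complex_of_real (2 * pi) * of_real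
     (Gamma (a\<^sub>2 - a\<^sub>1) * Gamma (a\<^sub>1 + b\<^sub>1) * Gamma (a\<^sub>1 + b\<^sub>2) * u powr a\<^sub>1 *
        hyp2F1 (a\<^sub>1 + b\<^sub>1) (a\<^sub>1 + b\<^sub>2) (1 + a\<^sub>1 - a\<^sub>2) u +
      Gamma (a\<^sub>1 - a\<^sub>2) * Gamma (a\<^sub>2 + b\<^sub>1) * Gamma (a\<^sub>2 + b\<^sub>2) * u powr a\<^sub>2 *
        hyp2F1 (a\<^sub>2 + b\<^sub>1) (a\<^sub>2 + b\<^sub>2) (1 + a\<^sub>2 - a\<^sub>1) u)"
proof -
  define x where "x = ln u"
  have x: "x < 0" "exp x = u" using u by (auto simp: x_def)
  have noint': "a\<^sub>2 - a\<^sub>1 \<notin> \<int>" using noint by (metis Ints_minus minus_diff_eq)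
  define f where "f = (\<lambda>s. barnes_integrand a\<^sub>1 a\<^sub>2 b\<^sub>1 b\<^sub>2 s * exp (- (s * of_real x)))"
  obtain d where d: "d < 0" "a\<^sub>1 + d > 0" "a\<^sub>2 + d > 0" "a\<^sub>1 + d \<notin> \<int>" "a\<^sub>2 + d \<notin> \<int>"
    using ex_shift_off_integers[OF pos(1,2)] .
  define p\<^sub>1 p\<^sub>2 q\<^sub>1 q\<^sub>2 where pq: "p\<^sub>1 = a\<^sub>1 + d" "p\<^sub>2 = a\<^sub>2 + d" "q\<^sub>1 = b\<^sub>1 - d" "q\<^sub>2 = b\<^sub>2 - d"
  have pq_pos: "p\<^sub>1 > 0" "p\<^sub>2 > 0" "q\<^sub>1 > 0" "q\<^sub>2 > 0" "p\<^sub>1 \<notin> \<int>" "p\<^sub>2 \<notin> \<int>"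
    using d pos by (auto simp: pq)
  define r where "r = (\<lambda>(a::real) (a'::real) (k::nat). complex_of_real (Gamma (a' - a) * Gamma (a + b\<^sub>1) * Gamma (a + b\<^sub>2) * u powr a *
      (fps_nth (fps_hypergeo [a + b\<^sub>1, a + b\<^sub>2] [1 + a - a'] 1) k * u ^ k)))"
  have res1: "residue f (of_real (- a\<^sub>1 - real k)) = r a\<^sub>1 a\<^sub>2 k" for k
    using residue_barnes[of a\<^sub>1 b\<^sub>1 b\<^sub>2 a\<^sub>2 x k] pos noint' u x by (simp add: f_def r_def powr_def x_def)
  have res2: "residue f (of_real (- a\<^sub>2 - real k)) = r a\<^sub>2 a\<^sub>1 k" for k
    using residue_barnes[of a\<^sub>2 b\<^sub>1 b\<^sub>2 a\<^sub>1 x k] pos noint u x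
    by (simp add: f_def r_def powr_def x_def barnes_integrand_commute[of a\<^sub>1 a\<^sub>2])
  have r_sums: "summable (r a a')" "(\<Sum>k. r a a' k) = complex_of_real (Gamma (a' - a) * Gamma (a + b\<^sub>1) * Gamma (a + b\<^sub>2) * u powr a *
      hyp2F1 (a + b\<^sub>1) (a + b\<^sub>2) (1 + a - a') u)" if "a > 0" "a - a' \<notin> \<int>" for a a'
  proof -
    have "1 + a - a' + real k \<noteq> 0" for k
    proof
      assume "1 + a - a' + real k = 0"
      hence "a - a' = of_int (- 1 - int k)" by simp
      thus False using that(2) Ints_of_int by metis
    qed
    hence s: "summable (\<lambda>k. fps_nth (fps_hypergeo [a + b\<^sub>1, a + b\<^sub>2] [1 + a - a'] 1) k * u ^ k)"
      using u that pos by (intro summable_hypergeo) auto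
    show "summable (r a a')" unfolding r_def by (intro summable_of_real summable_mult s)
    show "(\<Sum>k. r a a' k) = complex_of_real (Gamma (a' - a) * Gamma (a + b\<^sub>1) * Gamma (a + b\<^sub>2) * u powr a *
      hyp2F1 (a + b\<^sub>1) (a + b\<^sub>2) (1 + a - a') u)"
      unfolding r_def hyp2F1_def eval_fps_def
      by (subst suminf_of_real[symmetric], intro summable_mult s, subst suminf_mult[OF s], rule refl)
  qed
  define \<rho> where "\<rho> = (\<lambda>p q (k::nat). max 1 ((q + real k) / \<bar>p - 1 - real k\<bar>) :: real)"
  \<comment> \<open>Bounds the integrand on the line \<open>Re s = d - N\<close> as a multiple of the product of Gamma
      functions on the line \<open>Re s = d\<close>.\<close>
  define c where "c = (\<lambda>N::nat. exp (- d * x) * (\<Prod>k<N. u * \<rho> p\<^sub>1 q\<^sub>1 k * \<rho> p\<^sub>2 q\<^sub>2 k))"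
  let ?g = "\<lambda>t::real. barnes_integrand p\<^sub>1 p\<^sub>2 q\<^sub>1 q\<^sub>2 (\<i> * t)"
  have g_int: "integrable lborel (\<lambda>t. norm (?g t))"
    using pq_pos by (intro integrable_norm integrable_barnes_line)
  have f_line: "norm (f (Complex (d - real N) t)) \<le> c N * norm (?g t)" for N t
  proof -
    have e1: "complex_of_real a + Complex (d - real N) t = of_real (a + d) + \<i> * t - of_nat N"
      and e2: "complex_of_real a - Complex (d - real N) t = of_real (a - d) - \<i> * t + of_nat N" for a
      by (simp_all add: complex_eq_iff)
    have "norm (exp (- (Complex (d - real N) t * of_real x))) = exp (- d * x) * u ^ N"
      by (simp add: x(2)[symmetric] exp_of_nat_mult[symmetric] exp_add[symmetric] algebra_simps)
    moreover have "norm (barnes_integrand a\<^sub>1 a\<^sub>2 b\<^sub>1 b\<^sub>2 (Complex (d - real N) t)) =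
       norm (Gamma (p\<^sub>1 + \<i> * t - of_nat N) * Gamma (q\<^sub>1 - \<i> * t + of_nat N)) *
       norm (Gamma (p\<^sub>2 + \<i> * t - of_nat N) * Gamma (q\<^sub>2 - \<i> * t + of_nat N))"
      unfolding barnes_integrand_def e1 e2 pq norm_mult by (simp only: mult_ac)
    moreover have "norm (Gamma (p\<^sub>1 + \<i> * t - of_nat N) * Gamma (q\<^sub>1 - \<i> * t + of_nat N)) *
       norm (Gamma (p\<^sub>2 + \<i> * t - of_nat N) * Gamma (q\<^sub>2 - \<i> * t + of_nat N)) \<le>
       ((\<Prod>k<N. \<rho> p\<^sub>1 q\<^sub>1 k) * norm (Gamma (p\<^sub>1 + \<i> * t) * Gamma (q\<^sub>1 - \<i> * t))) *
       ((\<Prod>k<N. \<rho> p\<^sub>2 q\<^sub>2 k) * norm (Gamma (p\<^sub>2 + \<i> * t) * Gamma (q\<^sub>2 - \<i> * t)))"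
      unfolding \<rho>_def by (intro mult_mono norm_Gamma_pair_shift_left pq_pos)
        (auto intro!: mult_nonneg_nonneg prod_nonneg)
    ultimately have "norm (f (Complex (d - real N) t)) \<le>
       (((\<Prod>k<N. \<rho> p\<^sub>1 q\<^sub>1 k) * norm (Gamma (p\<^sub>1 + \<i> * t) * Gamma (q\<^sub>1 - \<i> * t))) *
       ((\<Prod>k<N. \<rho> p\<^sub>2 q\<^sub>2 k) * norm (Gamma (p\<^sub>2 + \<i> * t) * Gamma (q\<^sub>2 - \<i> * t)))) * (exp (- d * x) * u ^ N)"
      unfolding f_def norm_mult using u by (simp add: mult_right_mono)
    also have "\<dots> = c N * norm (?g t)"
      by (simp add: c_def barnes_integrand_def norm_mult prod.distrib mult_ac)
    finally show ?thesis .
  qed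
  have c_lim: "c \<longlonglongrightarrow> 0"
  proof -
    have "(\<lambda>N. \<Prod>k<N. u * \<rho> p\<^sub>1 q\<^sub>1 k * \<rho> p\<^sub>2 q\<^sub>2 k) \<longlonglongrightarrow> 0"
    proof (rule prod_tendsto_0_if_ratio_lt_1)
      show "(\<lambda>k. u * \<rho> p\<^sub>1 q\<^sub>1 k * \<rho> p\<^sub>2 q\<^sub>2 k) \<longlonglongrightarrow> u * 1 * 1"
        unfolding \<rho>_def by (intro tendsto_intros tendsto_pair_shift_ratio)
    qed (use u in \<open>auto simp: \<rho>_def\<close>)
    from tendsto_mult[OF tendsto_const this, of "exp (- d * x)"] show ?thesis by (simp add: c_def)
  qed
  have f_cont: "continuous_on UNIV (\<lambda>t. f (Complex l t))"
    if "a\<^sub>1 + l \<notin> \<int>\<^sub>\<le>\<^sub>0" "a\<^sub>2 + l \<notin> \<int>\<^sub>\<le>\<^sub>0" "b\<^sub>1 - l \<notin> \<int>\<^sub>\<le>\<^sub>0" "b\<^sub>2 - l \<notin> \<int>\<^sub>\<le>\<^sub>0" for l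
  proof -
    have "continuous_on UNIV (Complex l)" unfolding Complex_eq by (intro continuous_intros)
    thus ?thesis unfolding f_def using that by (intro continuous_intros continuous_on_barnes_vertical)
  qed
  have shifted: "a + (d - real N) \<notin> \<int>" if "a + d \<notin> \<int>" for a N
    using that by (metis Ints_add Ints_of_nat add_diff_eq diff_add_cancel)
  have int_left: "integrable lborel (\<lambda>t. f (Complex (d - real N) t))" for N
  proof (rule Bochner_Integration.integrable_bound)
    show "integrable lborel (\<lambda>t. c N * norm (?g t))" by (intro integrable_mult_right g_int)
    have "a\<^sub>1 + (d - real N) \<notin> \<int>\<^sub>\<le>\<^sub>0" "a\<^sub>2 + (d - real N) \<notin> \<int>\<^sub>\<le>\<^sub>0"
      using shifted[of _ N] d nonpos_Ints_Int by blast+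
    moreover have "b\<^sub>1 - (d - real N) \<notin> \<int>\<^sub>\<le>\<^sub>0" "b\<^sub>2 - (d - real N) \<notin> \<int>\<^sub>\<le>\<^sub>0"
      using pos d by (auto elim!: nonpos_Ints_cases)
    ultimately show "(\<lambda>t. f (Complex (d - real N) t)) \<in> borel_measurable lborel"
      using f_cont by (simp add: borel_measurable_continuous_onI)
    show "AE t in lborel. norm (f (Complex (d - real N) t)) \<le> norm (c N * norm (?g t))"
    proof (rule AE_I2)
      fix t
      have "c N * norm (?g t) \<le> \<bar>c N * norm (?g t)\<bar>" by simp
      with f_line[of N t] show "norm (f (Complex (d - real N) t)) \<le> norm (c N * norm (?g t))"
        unfolding real_norm_def by linarith
    qed
  qed
  have left_bound: "norm (LBINT t. f (Complex (d - real N) t)) \<le> c N * (LBINT t. norm (?g t))" for N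
  proof -
    have "norm (LBINT t. f (Complex (d - real N) t)) \<le> (LBINT t. norm (f (Complex (d - real N) t)))"
      by (rule integral_norm_bound)
    also have "\<dots> \<le> (LBINT t. c N * norm (?g t))"
      by (intro integral_mono integrable_norm int_left integrable_mult_right g_int f_line)
    also have "\<dots> = c N * (LBINT t. norm (?g t))" by (rule integral_mult_right_zero)
    finally show ?thesis .
  qed
  have left_lim: "(\<lambda>N. LBINT t. f (Complex (d - real N) t)) \<longlonglongrightarrow> 0"
  proof (rule Lim_null_comparison)
    show "\<forall>\<^sub>F N in sequentially. norm (LBINT t. f (Complex (d - real N) t)) \<le> c N * (LBINT t. norm (?g t))"
      using left_bound by (intro always_eventually) auto
    show "(\<lambda>N. c N * (LBINT t. norm (?g t))) \<longlonglongrightarrow> 0" using c_lim by (auto intro!: tendsto_eq_intros)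
  qed
  have line0: "f (Complex 0 t) = barnes_integrand a\<^sub>1 a\<^sub>2 b\<^sub>1 b\<^sub>2 (\<i> * t) * exp (- (\<i> * of_real (ln u * t)))" for t
    by (simp add: f_def Complex_eq x_def mult_ac)
  have int_right: "integrable lborel (\<lambda>t. f (Complex 0 t))"
  proof (rule Bochner_Integration.integrable_bound[OF integrable_barnes_line[OF pos]])
    have "a\<^sub>1 + 0 \<notin> \<int>\<^sub>\<le>\<^sub>0" "a\<^sub>2 + 0 \<notin> \<int>\<^sub>\<le>\<^sub>0" "b\<^sub>1 - 0 \<notin> \<int>\<^sub>\<le>\<^sub>0" "b\<^sub>2 - 0 \<notin> \<int>\<^sub>\<le>\<^sub>0"
      using pos by (auto elim!: nonpos_Ints_cases)
    thus "(\<lambda>t. f (Complex 0 t)) \<in> borel_measurable lborel"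
      using f_cont by (simp add: borel_measurable_continuous_onI)
    show "AE t in lborel. norm (f (Complex 0 t)) \<le> norm (barnes_integrand a\<^sub>1 a\<^sub>2 b\<^sub>1 b\<^sub>2 (\<i> * of_real t))"
      unfolding line0 by (rule AE_I2) (simp add: norm_mult)
  qed
  have shift: "(LBINT t. f (Complex 0 t)) = (LBINT t. f (Complex (d - real N) t)) +
     2 * of_real pi * ((\<Sum>k | p\<^sub>1 + real k < real N. r a\<^sub>1 a\<^sub>2 k) + (\<Sum>k | p\<^sub>2 + real k < real N. r a\<^sub>2 a\<^sub>1 k))" for N
  proof -
    let ?P = "\<lambda>a k. complex_of_real (- a - real k)"
    \<comment> \<open>All poles to the right of \<open>Re s = d - N - 1\<close>, so that the integrand is holomorphic off \<open>S\<close> in a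
        strip extending beyond the line \<open>Re s = d - N\<close>.\<close>
    define S where "S = ?P a\<^sub>1 ` {k. p\<^sub>1 + real k < real N + 1} \<union> ?P a\<^sub>2 ` {k. p\<^sub>2 + real k < real N + 1}"
    have fin: "finite {k. p + real k < y}" for p y :: real
    proof (rule finite_subset)
      show "{k. p + real k < y} \<subseteq> {..nat \<lceil>y - p\<rceil>}" by (auto, linarith)
    qed auto
    have inj: "inj (?P a)" for a by (auto simp: inj_def)
    obtain C1 where C1: "\<And>T \<sigma>. \<bar>T\<bar> \<ge> 1 \<Longrightarrow> \<sigma> \<in> {d - real N..0} \<Longrightarrow> norm (Gamma (a\<^sub>1 + Complex \<sigma> T)) \<le> C1 / \<bar>T\<bar>"
      using Gamma_horizontal_decay[where a=a\<^sub>1 and l="d - real N" and r=0] by blast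
    obtain C2 where C2: "\<And>T \<sigma>. \<bar>T\<bar> \<ge> 1 \<Longrightarrow> \<sigma> \<in> {d - real N..0} \<Longrightarrow> norm (Gamma (a\<^sub>2 + Complex \<sigma> T)) \<le> C2 / \<bar>T\<bar>"
      using Gamma_horizontal_decay[where a=a\<^sub>2 and l="d - real N" and r=0] by blast
    obtain C3 where C3: "\<And>T \<sigma>. \<bar>T\<bar> \<ge> 1 \<Longrightarrow> \<sigma> \<in> {0..real N - d} \<Longrightarrow> norm (Gamma (b\<^sub>1 + Complex \<sigma> T)) \<le> C3 / \<bar>T\<bar>"
      using Gamma_horizontal_decay[where a=b\<^sub>1 and l=0 and r="real N - d"] by blast
    obtain C4 where C4: "\<And>T \<sigma>. \<bar>T\<bar> \<ge> 1 \<Longrightarrow> \<sigma> \<in> {0..real N - d} \<Longrightarrow> norm (Gamma (b\<^sub>2 + Complex \<sigma> T)) \<le> C4 / \<bar>T\<bar>"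
      using Gamma_horizontal_decay[where a=b\<^sub>2 and l=0 and r="real N - d"] by blast
    define B where "B = (\<lambda>T::real. (C1 / \<bar>T\<bar>) * (C2 / \<bar>T\<bar>) * (C3 / \<bar>T\<bar>) * (C4 / \<bar>T\<bar>))"
    have bound: "norm (f (Complex \<sigma> T)) \<le> B T" if "\<bar>T\<bar> \<ge> 1" "\<sigma> \<in> {d - real N..0}" for \<sigma> T
    proof -
      have neg: "complex_of_real b - Complex \<sigma> T = b + Complex (-\<sigma>) (-T)" for b
        by (simp add: complex_eq_iff)
      have G3: "norm (Gamma (b\<^sub>1 - Complex \<sigma> T)) \<le> C3 / \<bar>T\<bar>" using C3[of "-T" "-\<sigma>"] that by (simp add: neg)
      have G4: "norm (Gamma (b\<^sub>2 - Complex \<sigma> T)) \<le> C4 / \<bar>T\<bar>" using C4[of "-T" "-\<sigma>"] that by (simp add: neg)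
      have "\<sigma> * x \<ge> 0" using that x by (intro mult_nonpos_nonpos) auto
      hence E: "norm (exp (- (Complex \<sigma> T * of_real x))) \<le> 1" by simp
      have nonneg: "0 \<le> C / \<bar>T\<bar>" if "norm (Gamma w) \<le> C / \<bar>T\<bar>" for C and w :: complex
        using that norm_ge_zero order_trans by blast
      note G = C1[OF that] C2[OF that] G3 G4
      have "norm (f (Complex \<sigma> T)) \<le> B T * 1"
        unfolding f_def barnes_integrand_def norm_mult B_def
        by (intro mult_mono G E mult_nonneg_nonneg nonneg[OF G(1)] nonneg[OF G(2)] nonneg[OF G(3)] nonneg[OF G(4)] norm_ge_zero)
      thus ?thesis by simp
    qed
    have "(LBINT t. f (Complex 0 t)) - (LBINT t. f (Complex (d - real N) t)) =
        2 * of_real pi * (\<Sum>p\<in>{p\<in>S. d - real N < Re p \<and> Re p < 0}. residue f p)"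
    proof (rule vertical_line_shift[where B = B and l' = "d - real N - 1" and r' = "min b\<^sub>1 b\<^sub>2"])
      show "finite S" unfolding S_def by (intro finite_UnI finite_imageI fin)
      show "(B \<longlongrightarrow> 0) at_top" unfolding B_def by real_asymp
      show "\<forall>\<^sub>F T in at_top. \<forall>\<sigma>\<in>{d - real N..0}. norm (f (Complex \<sigma> T)) \<le> B T \<and> norm (f (Complex \<sigma> (- T))) \<le> B T"
        using eventually_ge_at_top[of 1]
      proof eventually_elim
        case (elim T)
        have "B (- T) = B T" by (simp add: B_def)
        thus ?case using bound[of T] bound[of "-T"] elim by auto
      qed
      show "f holomorphic_on {s. d - real N - 1 < Re s \<and> Re s < min b\<^sub>1 b\<^sub>2} - S"
      proof -
        have A: "complex_of_real a + s \<notin> \<int>\<^sub>\<le>\<^sub>0"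
          if s: "d - real N - 1 < Re s" "s \<notin> ?P a ` {k. a + d + real k < real N + 1}" for a s
        proof
          assume "complex_of_real a + s \<in> \<int>\<^sub>\<le>\<^sub>0"
          then obtain n where "complex_of_real a + s = - of_nat n" by (auto elim!: nonpos_Ints_cases')
          hence sn: "s = ?P a n" by (auto simp: complex_eq_iff)
          with s(1) have "a + d + real n < real N + 1" by simp
          with sn s(2) show False by blast
        qed
        have Bb: "complex_of_real b - s \<notin> \<int>\<^sub>\<le>\<^sub>0" if "Re s < b" for b s
          using that by (intro not_nonpos_Int_if_Re_pos) auto
        show ?thesis unfolding f_def barnes_integrand_def S_def pq
          by (intro holomorphic_intros A Bb) auto
      qed
      show "d - real N - 1 < Re p \<and> Re p < min b\<^sub>1 b\<^sub>2 \<and> Re p \<noteq> d - real N \<and> Re p \<noteq> 0" if "p \<in> S" for p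
      proof -
        have "- a - real k \<noteq> d - real N" if "a + d \<notin> \<int>" for a k
        proof
          assume "- a - real k = d - real N"
          hence "a + d = of_int (int N - int k)" by simp
          thus False using that Ints_of_int by metis
        qed
        thus ?thesis using that d pos by (auto simp: S_def pq)
      qed
    qed (use int_left int_right d pos in auto)
    also have "{p\<in>S. d - real N < Re p \<and> Re p < 0} =
       ?P a\<^sub>1 ` {k. p\<^sub>1 + real k < real N} \<union> ?P a\<^sub>2 ` {k. p\<^sub>2 + real k < real N}"
      using pos by (auto simp: S_def pq)
    also have "(\<Sum>p\<in>\<dots>. residue f p) =
        (\<Sum>p\<in>?P a\<^sub>1 ` {k. p\<^sub>1 + real k < real N}. residue f p) + (\<Sum>p\<in>?P a\<^sub>2 ` {k. p\<^sub>2 + real k < real N}. residue f p)"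
    proof (intro sum.union_disjoint finite_imageI fin)
      show "?P a\<^sub>1 ` {k. p\<^sub>1 + real k < real N} \<inter> ?P a\<^sub>2 ` {k. p\<^sub>2 + real k < real N} = {}"
      proof (rule ccontr)
        assume "\<not> ?thesis"
        then obtain k m where "?P a\<^sub>1 k = ?P a\<^sub>2 m" by blast
        hence "- a\<^sub>1 - real k = - a\<^sub>2 - real m" by (simp only: of_real_eq_iff)
        hence "a\<^sub>1 - a\<^sub>2 = of_int (int m - int k)" by simp
        thus False using noint Ints_of_int by metis
      qed
    qed
    also have "\<dots> = (\<Sum>k | p\<^sub>1 + real k < real N. r a\<^sub>1 a\<^sub>2 k) + (\<Sum>k | p\<^sub>2 + real k < real N. r a\<^sub>2 a\<^sub>1 k)"
      by (subst (1 2) sum.reindex[OF inj_on_subset[OF inj]]) (simp_all only: o_def res1 res2 subset_UNIV)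
    finally show ?thesis by (simp add: algebra_simps)
  qed
  have "(\<lambda>N. (LBINT t. f (Complex (d - real N) t)) +
     2 * of_real pi * ((\<Sum>k | p\<^sub>1 + real k < real N. r a\<^sub>1 a\<^sub>2 k) + (\<Sum>k | p\<^sub>2 + real k < real N. r a\<^sub>2 a\<^sub>1 k)))
     \<longlonglongrightarrow> 0 + 2 * of_real pi * ((\<Sum>k. r a\<^sub>1 a\<^sub>2 k) + (\<Sum>k. r a\<^sub>2 a\<^sub>1 k))"
    by (intro tendsto_intros left_lim tendsto_sum_below r_sums pos noint noint')
  hence "(\<lambda>N::nat. LBINT t. f (Complex 0 t)) \<longlonglongrightarrow> 2 * of_real pi * ((\<Sum>k. r a\<^sub>1 a\<^sub>2 k) + (\<Sum>k. r a\<^sub>2 a\<^sub>1 k))"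
    by (simp only: shift[symmetric] add_0_left)
  hence "(LBINT t. f (Complex 0 t)) = 2 * of_real pi * ((\<Sum>k. r a\<^sub>1 a\<^sub>2 k) + (\<Sum>k. r a\<^sub>2 a\<^sub>1 k))"
    using LIMSEQ_unique tendsto_const by blast
  thus ?thesis unfolding line0 r_sums(2)[OF pos(1) noint] r_sums(2)[OF pos(2) noint'] by simp
qed

lemma barnes_integral_reflect:
  fixes a\<^sub>1 a\<^sub>2 b\<^sub>1 b\<^sub>2 x :: real
  shows "(LBINT t. barnes_integrand a\<^sub>1 a\<^sub>2 b\<^sub>1 b\<^sub>2 (\<i> * t) * exp (- (\<i> * of_real (x * t)))) =
    (LBINT t. barnes_integrand b\<^sub>1 b\<^sub>2 a\<^sub>1 a\<^sub>2 (\<i> * t) * exp (- (\<i> * of_real (- x * t))))"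
  using lborel_integral_real_affine[of "-1" "\<lambda>t. barnes_integrand a\<^sub>1 a\<^sub>2 b\<^sub>1 b\<^sub>2 (\<i> * t) * exp (- (\<i> * of_real (x * t)))" 0]
  by (simp add: barnes_integrand_def mult_ac)

section \<open>The Meijer G-function\<close>

lemma is_pole_Gamma_affine:
  fixes b s :: complex
  shows "is_pole (\<lambda>s. Gamma (b + s)) s \<longleftrightarrow> b + s \<in> \<int>\<^sub>\<le>\<^sub>0"
    and "is_pole (\<lambda>s. Gamma (b - s)) s \<longleftrightarrow> b - s \<in> \<int>\<^sub>\<le>\<^sub>0"
proof -
  have pole: "is_pole (\<lambda>s. Gamma (h s)) s \<longleftrightarrow> h s \<in> \<int>\<^sub>\<le>\<^sub>0"
    if h: "h holomorphic_on UNIV" "filterlim h (at (h s)) (at s)" for h :: "complex \<Rightarrow> complex"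
  proof
    assume "h s \<in> \<int>\<^sub>\<le>\<^sub>0"
    hence "is_pole Gamma (h s)" by (auto elim!: nonpos_Ints_cases' intro: is_pole_Gamma)
    thus "is_pole (\<lambda>s. Gamma (h s)) s"
      unfolding is_pole_def using h(2) by (rule filterlim_compose)
  next
    assume pole: "is_pole (\<lambda>s. Gamma (h s)) s"
    show "h s \<in> \<int>\<^sub>\<le>\<^sub>0"
    proof (rule ccontr)
      assume "h s \<notin> \<int>\<^sub>\<le>\<^sub>0"
      moreover have "open {s. h s \<notin> \<int>\<^sub>\<le>\<^sub>0}"
        using h(1) by (intro open_vimage_Compl_integers holomorphic_on_imp_continuous_on) auto
      moreover have "(\<lambda>s. Gamma (h s)) holomorphic_on {s. h s \<notin> \<int>\<^sub>\<le>\<^sub>0}"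
        using h(1) by (intro holomorphic_Gamma') (auto intro: holomorphic_on_subset)
      ultimately show False using not_is_pole_holomorphic pole by blast
    qed
  qed
  have "filterlim (\<lambda>s. b + s) (at (b + s)) (at s)"
    by (auto simp: filterlim_at eventually_at_filter intro!: tendsto_intros always_eventually)
  thus "is_pole (\<lambda>s. Gamma (b + s)) s \<longleftrightarrow> b + s \<in> \<int>\<^sub>\<le>\<^sub>0"
    by (intro pole holomorphic_intros)
  have "filterlim (\<lambda>s. b - s) (at (b - s)) (at s)"
    by (auto simp: filterlim_at eventually_at_filter intro!: tendsto_intros always_eventually)
  thus "is_pole (\<lambda>s. Gamma (b - s)) s \<longleftrightarrow> b - s \<in> \<int>\<^sub>\<le>\<^sub>0"
    by (intro pole holomorphic_intros)
qed

lemma meijer_G_separates_iff: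
  fixes \<alpha>\<^sub>1 \<alpha>\<^sub>2 \<beta>\<^sub>1 \<beta>\<^sub>2 \<kappa> :: real
  shows "meijer_G_separates 2 2 [- of_real \<beta>\<^sub>1, - of_real \<beta>\<^sub>2] [of_real \<alpha>\<^sub>1, of_real \<alpha>\<^sub>2] \<kappa> \<longleftrightarrow>
    - \<alpha>\<^sub>1 < \<kappa> \<and> - \<alpha>\<^sub>2 < \<kappa> \<and> \<kappa> < 1 + \<beta>\<^sub>1 \<and> \<kappa> < 1 + \<beta>\<^sub>2"
proof -
  have left: "(\<forall>s. complex_of_real a + s \<in> \<int>\<^sub>\<le>\<^sub>0 \<longrightarrow> Re s < \<kappa>) \<longleftrightarrow> - a < \<kappa>" for a
  proof
    assume "\<forall>s. complex_of_real a + s \<in> \<int>\<^sub>\<le>\<^sub>0 \<longrightarrow> Re s < \<kappa>"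
    from this[rule_format, of "of_real (- a)"] show "- a < \<kappa>" by simp
  qed (auto elim!: nonpos_Ints_cases simp: complex_eq_iff)
  have right: "(\<forall>s. complex_of_real b - s \<in> \<int>\<^sub>\<le>\<^sub>0 \<longrightarrow> \<kappa> < Re s) \<longleftrightarrow> \<kappa> < b" for b
  proof
    assume "\<forall>s. complex_of_real b - s \<in> \<int>\<^sub>\<le>\<^sub>0 \<longrightarrow> \<kappa> < Re s"
    from this[rule_format, of "of_real b"] show "\<kappa> < b" by simp
  qed (auto elim!: nonpos_Ints_cases simp: complex_eq_iff)
  have two: "(\<forall>j<2. P j) \<longleftrightarrow> P 0 \<and> P (1::nat)" for P
    by (auto simp: numeral_2_eq_2 less_Suc_eq)
  have "1 - - complex_of_real b - s = of_real (1 + b) - s" for b s by simp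
  thus ?thesis
    unfolding meijer_G_separates_def two
    by (simp add: is_pole_Gamma_affine left right del: of_real_add of_real_1 of_real_minus)
qed

lemma meijer_G_integrand_two_two:
  "meijer_G_integrand 2 2 [- of_real \<beta>\<^sub>1, - of_real \<beta>\<^sub>2] [of_real \<alpha>\<^sub>1, of_real \<alpha>\<^sub>2] z s =
     barnes_integrand \<alpha>\<^sub>1 \<alpha>\<^sub>2 (1 + \<beta>\<^sub>1) (1 + \<beta>\<^sub>2) s * z powr (- s)"
  by (simp add: meijer_G_integrand_def barnes_integrand_def numeral_2_eq_2 mult_ac)

lemma meijer_G_swap:
  "meijer_G 2 2 [- of_real \<beta>\<^sub>2, - of_real \<beta>\<^sub>1] [of_real \<alpha>\<^sub>2, of_real \<alpha>\<^sub>1] z =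
   meijer_G 2 2 [- of_real \<beta>\<^sub>1, - of_real \<beta>\<^sub>2] [of_real \<alpha>\<^sub>1, of_real \<alpha>\<^sub>2] z"
proof -
  have "meijer_G_integrand 2 2 [- of_real \<beta>\<^sub>2, - of_real \<beta>\<^sub>1] [of_real \<alpha>\<^sub>2, of_real \<alpha>\<^sub>1] z =
      meijer_G_integrand 2 2 [- of_real \<beta>\<^sub>1, - of_real \<beta>\<^sub>2] [of_real \<alpha>\<^sub>1, of_real \<alpha>\<^sub>2] z"
    by (simp add: fun_eq_iff meijer_G_integrand_two_two barnes_integrand_def mult_ac)
  moreover have "meijer_G_separates 2 2 [- of_real \<beta>\<^sub>2, - of_real \<beta>\<^sub>1] [of_real \<alpha>\<^sub>2, of_real \<alpha>\<^sub>1] =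
      meijer_G_separates 2 2 [- of_real \<beta>\<^sub>1, - of_real \<beta>\<^sub>2] [of_real \<alpha>\<^sub>1, of_real \<alpha>\<^sub>2]"
    by (auto simp: fun_eq_iff meijer_G_separates_iff)
  ultimately show ?thesis by (simp add: meijer_G_def)
qed

lemma meijer_G_zero: "meijer_G m n as bs 0 = 0"
proof -
  have "meijer_G_integrand m n as bs 0 = (\<lambda>s. 0)" by (simp add: fun_eq_iff meijer_G_integrand_def)
  thus ?thesis using vertical_line_integral_eq[of "\<lambda>s. 0"] by (simp add: meijer_G_def)
qed

text \<open>
  The line chosen in the definition of the Meijer function is only known to separate the poles, so
  \<open>\<kappa>\<close> is obtained here together with the positivity of the shifted parameters. It is the same for
  all \<open>u\<close>, which is what makes continuity in \<open>u\<close> accessible.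
\<close>

lemma meijer_G_eq_barnes_integral:
  fixes \<alpha>\<^sub>1 \<alpha>\<^sub>2 \<beta>\<^sub>1 \<beta>\<^sub>2 :: real
  assumes "\<alpha>\<^sub>1 > -1" "\<alpha>\<^sub>2 > -1" "\<beta>\<^sub>1 > 0" "\<beta>\<^sub>2 > 0"
  obtains \<kappa> where "\<alpha>\<^sub>1 + \<kappa> > 0" "\<alpha>\<^sub>2 + \<kappa> > 0" "1 + \<beta>\<^sub>1 - \<kappa> > 0" "1 + \<beta>\<^sub>2 - \<kappa> > 0"
    "\<And>u. u > 0 \<Longrightarrow> meijer_G 2 2 [- of_real \<beta>\<^sub>1, - of_real \<beta>\<^sub>2] [of_real \<alpha>\<^sub>1, of_real \<alpha>\<^sub>2] (of_real u) =
       of_real (u powr (- \<kappa>) / (2 * pi)) *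
       (LBINT t. barnes_integrand (\<alpha>\<^sub>1 + \<kappa>) (\<alpha>\<^sub>2 + \<kappa>) (1 + \<beta>\<^sub>1 - \<kappa>) (1 + \<beta>\<^sub>2 - \<kappa>) (\<i> * t) * exp (- (\<i> * of_real (ln u * t))))"
proof -
  let ?sep = "meijer_G_separates 2 2 [- of_real \<beta>\<^sub>1, - of_real \<beta>\<^sub>2] [of_real \<alpha>\<^sub>1, of_real \<alpha>\<^sub>2]"
  define \<kappa> where "\<kappa> = (SOME \<kappa>. ?sep \<kappa>)"
  \<comment> \<open>The line \<open>Re s = 1\<close> separates because \<open>- \<alpha>\<^sub>j < 1 < 1 + \<beta>\<^sub>j\<close>.\<close>
  have "?sep 1" using assms by (simp add: meijer_G_separates_iff)
  hence "?sep \<kappa>" unfolding \<kappa>_def by (rule someI)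
  hence pos: "\<alpha>\<^sub>1 + \<kappa> > 0" "\<alpha>\<^sub>2 + \<kappa> > 0" "1 + \<beta>\<^sub>1 - \<kappa> > 0" "1 + \<beta>\<^sub>2 - \<kappa> > 0"
    by (auto simp: meijer_G_separates_iff)
  show ?thesis
  proof (rule that[OF pos])
    fix u :: real assume u: "u > 0"
    let ?b = "barnes_integrand (\<alpha>\<^sub>1 + \<kappa>) (\<alpha>\<^sub>2 + \<kappa>) (1 + \<beta>\<^sub>1 - \<kappa>) (1 + \<beta>\<^sub>2 - \<kappa>)"
    let ?f = "meijer_G_integrand 2 2 [- of_real \<beta>\<^sub>1, - of_real \<beta>\<^sub>2] [of_real \<alpha>\<^sub>1, of_real \<alpha>\<^sub>2] (of_real u)"
    have f_eq: "?f (Complex \<kappa> t) = of_real (u powr (- \<kappa>)) * (?b (\<i> * t) * exp (- (\<i> * of_real (ln u * t))))" for t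
    proof -
      have "of_real u powr (- Complex \<kappa> t) = of_real (u powr (- \<kappa>)) * exp (- (\<i> * of_real (ln u * t)))"
        using u by (simp add: powr_def Complex_eq Ln_of_real exp_of_real[symmetric] exp_add[symmetric] algebra_simps)
      moreover have "barnes_integrand \<alpha>\<^sub>1 \<alpha>\<^sub>2 (1 + \<beta>\<^sub>1) (1 + \<beta>\<^sub>2) (Complex \<kappa> t) = ?b (\<i> * t)"
        by (simp add: barnes_integrand_def Complex_eq algebra_simps)
      ultimately show ?thesis by (simp add: meijer_G_integrand_two_two mult_ac)
    qed
    have "continuous_on UNIV (\<lambda>t. ?b (Complex 0 t))"
      using pos by (intro continuous_on_barnes_vertical) (auto elim!: nonpos_Ints_cases)
    hence cont: "continuous_on UNIV (\<lambda>t::real. ?b (\<i> * t))" by (simp add: Complex_eq)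
    have int: "integrable lborel (\<lambda>t::real. ?b (\<i> * t))" by (rule integrable_barnes_line[OF pos])
    have [measurable]: "(\<lambda>t::real. ?b (\<i> * t)) \<in> borel_measurable borel"
      using cont by (rule borel_measurable_continuous_onI)
    have "integrable lborel (\<lambda>t. ?b (\<i> * t) * exp (- (\<i> * of_real (ln u * t))))"
      by (rule Bochner_Integration.integrable_bound[OF int]) (auto simp: norm_mult)
    hence "integrable lborel (\<lambda>t. ?f (Complex \<kappa> t))" unfolding f_eq by (rule integrable_mult_right)
    moreover have "continuous_on UNIV (\<lambda>t. ?f (Complex \<kappa> t))"
      unfolding f_eq by (intro continuous_intros cont)
    ultimately have "vertical_line_integral \<kappa> ?f = \<i> * (LBINT t. ?f (Complex \<kappa> t))"
      by (intro vertical_line_integral_eq)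
    also have "(LBINT t. ?f (Complex \<kappa> t)) = of_real (u powr (- \<kappa>)) *
        (LBINT t. ?b (\<i> * t) * exp (- (\<i> * of_real (ln u * t))))"
      unfolding f_eq by (rule integral_mult_right_zero)
    finally show "meijer_G 2 2 [- of_real \<beta>\<^sub>1, - of_real \<beta>\<^sub>2] [of_real \<alpha>\<^sub>1, of_real \<alpha>\<^sub>2] (of_real u) =
       of_real (u powr (- \<kappa>) / (2 * pi)) * (LBINT t. ?b (\<i> * t) * exp (- (\<i> * of_real (ln u * t))))"
      unfolding meijer_G_def \<kappa>_def by (simp add: field_simps)
  qed
qed

lemma meijer_G_eq_real_integral:
  fixes \<alpha>\<^sub>1 \<alpha>\<^sub>2 \<beta>\<^sub>1 \<beta>\<^sub>2 u :: real
  assumes "\<alpha>\<^sub>1 > -1" "\<alpha>\<^sub>2 > -1" "\<beta>\<^sub>1 > 0" "\<beta>\<^sub>2 > 0" "u \<ge> 0"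
  shows "meijer_G 2 2 [- of_real \<beta>\<^sub>1, - of_real \<beta>\<^sub>2] [of_real \<alpha>\<^sub>1, of_real \<alpha>\<^sub>2] (of_real u) =
     of_real (Gamma (\<alpha>\<^sub>1 + 1 + \<beta>\<^sub>1) * Gamma (\<alpha>\<^sub>2 + 1 + \<beta>\<^sub>2) * (u powr \<alpha>\<^sub>1 *
       (LBINT v:{0<..}. v powr (\<beta>\<^sub>1 + \<alpha>\<^sub>2) * (u + v) powr (- (\<alpha>\<^sub>1 + 1 + \<beta>\<^sub>1)) * (1 + v) powr (- (\<alpha>\<^sub>2 + 1 + \<beta>\<^sub>2)))))"
proof (cases "u = 0")
  case True
  thus ?thesis by (simp add: meijer_G_zero)
next
  case False
  hence u: "u > 0" using assms by simp
  obtain \<kappa> where \<kappa>: "\<alpha>\<^sub>1 + \<kappa> > 0" "\<alpha>\<^sub>2 + \<kappa> > 0" "1 + \<beta>\<^sub>1 - \<kappa> > 0" "1 + \<beta>\<^sub>2 - \<kappa> > 0"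
    and G: "\<And>u. u > 0 \<Longrightarrow> meijer_G 2 2 [- of_real \<beta>\<^sub>1, - of_real \<beta>\<^sub>2] [of_real \<alpha>\<^sub>1, of_real \<alpha>\<^sub>2] (of_real u) =
       of_real (u powr (- \<kappa>) / (2 * pi)) *
       (LBINT t. barnes_integrand (\<alpha>\<^sub>1 + \<kappa>) (\<alpha>\<^sub>2 + \<kappa>) (1 + \<beta>\<^sub>1 - \<kappa>) (1 + \<beta>\<^sub>2 - \<kappa>) (\<i> * t) * exp (- (\<i> * of_real (ln u * t))))"
    using meijer_G_eq_barnes_integral[OF assms(1-4)] by blast
  have e: "\<alpha>\<^sub>1 + \<kappa> + (1 + \<beta>\<^sub>1 - \<kappa>) = \<alpha>\<^sub>1 + 1 + \<beta>\<^sub>1" "\<alpha>\<^sub>2 + \<kappa> + (1 + \<beta>\<^sub>2 - \<kappa>) = \<alpha>\<^sub>2 + 1 + \<beta>\<^sub>2"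
    "\<alpha>\<^sub>2 + \<kappa> + (1 + \<beta>\<^sub>1 - \<kappa>) - 1 = \<beta>\<^sub>1 + \<alpha>\<^sub>2" by simp_all
  have p: "u powr (- \<kappa>) * u powr (\<alpha>\<^sub>1 + \<kappa>) = u powr \<alpha>\<^sub>1" by (simp flip: powr_add)
  let ?I = "LBINT v:{0<..}. v powr (\<beta>\<^sub>1 + \<alpha>\<^sub>2) * (u + v) powr (- (\<alpha>\<^sub>1 + 1 + \<beta>\<^sub>1)) * (1 + v) powr (- (\<alpha>\<^sub>2 + 1 + \<beta>\<^sub>2))"
  have "meijer_G 2 2 [- of_real \<beta>\<^sub>1, - of_real \<beta>\<^sub>2] [of_real \<alpha>\<^sub>1, of_real \<alpha>\<^sub>2] (of_real u) =
     of_real (u powr (- \<kappa>) / (2 * pi)) * (of_real (2 * pi) *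
     of_real (Gamma (\<alpha>\<^sub>1 + 1 + \<beta>\<^sub>1) * Gamma (\<alpha>\<^sub>2 + 1 + \<beta>\<^sub>2) * (u powr (\<alpha>\<^sub>1 + \<kappa>) * ?I)))"
    unfolding G[OF u] barnes_integral_eq_convolution[OF \<kappa>] log_beta_kernel_convolution[OF u] e ..
  also have "\<dots> = of_real (Gamma (\<alpha>\<^sub>1 + 1 + \<beta>\<^sub>1) * Gamma (\<alpha>\<^sub>2 + 1 + \<beta>\<^sub>2) * ((u powr (- \<kappa>) * u powr (\<alpha>\<^sub>1 + \<kappa>)) * ?I))"
    unfolding of_real_mult[symmetric] by (rule arg_cong[of _ _ of_real]) simp
  finally show ?thesis unfolding p .
qed

section \<open>Behaviour at the boundary of the disc of convergence\<close>

lemma tendsto_fourier_integral: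
  fixes g :: "real \<Rightarrow> complex" and x :: real
  assumes "integrable lborel g"
  shows "((\<lambda>y. LBINT t. g t * exp (- (\<i> * of_real (y * t)))) \<longlongrightarrow> (LBINT t. g t * exp (- (\<i> * of_real (x * t))))) (at x)"
  unfolding tendsto_at_iff_sequentially o_def
proof (intro allI impI)
  fix X :: "nat \<Rightarrow> real" assume X: "X \<longlonglongrightarrow> x"
  have [measurable]: "g \<in> borel_measurable borel" using assms by (auto dest: borel_measurable_integrable)
  show "(\<lambda>n. LBINT t. g t * exp (- (\<i> * of_real (X n * t)))) \<longlonglongrightarrow> (LBINT t. g t * exp (- (\<i> * of_real (x * t))))"
  proof (rule integral_dominated_convergence[where w = "\<lambda>t. norm (g t)"])
    show "AE t in lborel. (\<lambda>n. g t * exp (- (\<i> * of_real (X n * t)))) \<longlonglongrightarrow> g t * exp (- (\<i> * of_real (x * t)))"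
      by (intro AE_I2 tendsto_intros X)
    show "AE t in lborel. norm (g t * exp (- (\<i> * of_real (X n * t)))) \<le> norm (g t)" for n
      by (rule AE_I2) (simp add: norm_mult)
  qed (use assms in auto)
qed

text \<open>
  Successive coefficients have quotient \<open>(A + n) (B + n) / ((n + 1) (c + n))\<close>, which is positive as
  soon as \<open>c + n\<close> is.
\<close>

lemma hypergeo_eventually_constant_sign:
  fixes A B c :: real
  assumes "A > 0" "B > 0" "c + real N > 0" "n \<ge> N"
  shows "\<bar>fps_nth (fps_hypergeo [A, B] [c] 1) n\<bar> =
    sgn (fps_nth (fps_hypergeo [A, B] [c] 1) N) * fps_nth (fps_hypergeo [A, B] [c] 1) n"
proof -
  let ?h = "fps_nth (fps_hypergeo [A, B] [c] 1)"
  have "sgn (?h n) = sgn (?h N)" using assms(4)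
  proof (induction n rule: dec_induct)
    case (step n)
    have "(A + real n) * (B + real n) / ((real n + 1) * (c + real n)) > 0"
      using assms step.hyps by (intro divide_pos_pos mult_pos_pos) auto
    moreover have "?h (Suc n) = (A + real n) * (B + real n) / ((real n + 1) * (c + real n)) * ?h n"
      unfolding fps_hypergeo_rec by (simp add: add.commute)
    ultimately have "sgn (?h (Suc n)) = 1 * sgn (?h n)" by (simp only: sgn_mult sgn_pos)
    with step.IH show ?case by (simp only: mult_1_left)
  qed simp
  thus ?thesis by (metis abs_sgn mult.commute)
qed

text \<open>
  This case of Abel's theorem is elementary: since the coefficients eventually have constant sign,
  convergence at 1 is absolute, and the Weierstrass test gives continuity on \<open>[0, 1]\<close>.
\<close>

lemma hyp2F1_tendsto_1:
  fixes A B c :: real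
  assumes "A > 0" "B > 0" and conv: "hyp2F1_converges A B c 1"
  shows "(hyp2F1 A B c \<longlongrightarrow> hyp2F1 A B c 1) (at_left 1)"
proof -
  let ?h = "fps_nth (fps_hypergeo [A, B] [c] 1)"
  obtain N :: nat where "real N > - c" using reals_Archimedean2 by blast
  hence N: "c + real N > 0" by simp
  have "summable ?h" using conv unfolding hyp2F1_converges_def power_one mult_1_right .
  hence "summable (\<lambda>n. sgn (?h N) * ?h (n + N))" by (intro summable_mult) (simp only: summable_iff_shift)
  also have "(\<lambda>n. sgn (?h N) * ?h (n + N)) = (\<lambda>n. \<bar>?h (n + N)\<bar>)"
    by (intro ext hypergeo_eventually_constant_sign[OF assms(1,2) N, symmetric]) simp
  finally have abs: "summable (\<lambda>n. \<bar>?h n\<bar>)" by (rule summable_iff_shift[THEN iffD1])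
  have "uniform_limit {0..1} (\<lambda>n z. \<Sum>k<n. ?h k * z ^ k) (\<lambda>z. \<Sum>k. ?h k * z ^ k) sequentially"
  proof (rule Weierstrass_m_test[OF _ abs])
    fix n and z :: real assume "z \<in> {0..1}"
    hence "\<bar>?h n\<bar> * z ^ n \<le> \<bar>?h n\<bar> * 1" by (intro mult_left_mono power_le_one) auto
    thus "norm (?h n * z ^ n) \<le> \<bar>?h n\<bar>" using \<open>z \<in> {0..1}\<close> by (simp add: abs_mult)
  qed
  hence "continuous_on {0..1} (\<lambda>z. \<Sum>k. ?h k * z ^ k)"
    by (rule uniform_limit_theorem[OF always_eventually, rotated])
      (rule trivial_limit_sequentially, intro allI continuous_intros)
  hence "continuous_on {0..1} (hyp2F1 A B c)" by (simp add: hyp2F1_def[abs_def] eval_fps_def)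
  hence "(hyp2F1 A B c \<longlongrightarrow> hyp2F1 A B c 1) (at 1 within {0..1})" by (auto simp: continuous_on_def)
  thus ?thesis by (simp add: at_within_Icc_at_left)
qed

section \<open>The Mellin convolution of two type-2 beta densities\<close>

lemma mellin_convolution_type2_beta:
  fixes \<alpha>\<^sub>1 \<alpha>\<^sub>2 \<beta>\<^sub>1 \<beta>\<^sub>2 u :: real
  assumes "u \<ge> 0"
  shows "mellin_convolution (type2_beta_density \<alpha>\<^sub>1 \<beta>\<^sub>1) (type2_beta_density \<alpha>\<^sub>2 \<beta>\<^sub>2) u =
     Gamma (\<alpha>\<^sub>1 + 1 + \<beta>\<^sub>1) / (Gamma (\<alpha>\<^sub>1 + 1) * Gamma \<beta>\<^sub>1) *
     (Gamma (\<alpha>\<^sub>2 + 1 + \<beta>\<^sub>2) / (Gamma (\<alpha>\<^sub>2 + 1) * Gamma \<beta>\<^sub>2)) * u powr \<alpha>\<^sub>1 *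
       (LBINT v:{0<..}. v powr (\<beta>\<^sub>1 + \<alpha>\<^sub>2) * (u + v) powr (- (\<alpha>\<^sub>1 + 1 + \<beta>\<^sub>1)) * (1 + v) powr (- (\<alpha>\<^sub>2 + 1 + \<beta>\<^sub>2)))"
    (is "_ = ?c1 * ?c2 * _ * (LBINT v:_. ?I v)")
proof -
  have eq: "1 / v * type2_beta_density \<alpha>\<^sub>1 \<beta>\<^sub>1 (u / v) * type2_beta_density \<alpha>\<^sub>2 \<beta>\<^sub>2 v = ?c1 * ?c2 * u powr \<alpha>\<^sub>1 * ?I v"
    if v: "v > 0" for v
  proof -
    have quot: "((u + v) / v) powr (- p) = (u + v) powr (- p) * v powr p" for p
    proof -
      have "((u + v) / v) powr p = (u + v) powr p / v powr p"
        using v assms by (simp add: powr_divide)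
      show ?thesis unfolding powr_minus \<open>((u + v) / v) powr p = _\<close> by (simp add: divide_inverse mult.commute)
    qed
    have "1 + u / v = (u + v) / v" using v by (simp add: field_simps)
    hence A: "(1 + u / v) powr (- (\<alpha>\<^sub>1 + 1 + \<beta>\<^sub>1)) = (u + v) powr (- (\<alpha>\<^sub>1 + 1 + \<beta>\<^sub>1)) * v powr (\<alpha>\<^sub>1 + 1 + \<beta>\<^sub>1)"
      by (simp only: quot)
    have B: "(u / v) powr \<alpha>\<^sub>1 = u powr \<alpha>\<^sub>1 * v powr (- \<alpha>\<^sub>1)"
      using v assms by (simp add: powr_divide powr_minus_divide)
    have C: "1 / v * v powr (- \<alpha>\<^sub>1) * v powr (\<alpha>\<^sub>1 + 1 + \<beta>\<^sub>1) * v powr \<alpha>\<^sub>2 = v powr (\<beta>\<^sub>1 + \<alpha>\<^sub>2)"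
    proof -
      have "1 / v = v powr (-1)" using v by (simp add: powr_minus_divide)
      thus ?thesis unfolding powr_add[symmetric]
        by (simp only: powr_add[symmetric]) (rule arg_cong[of _ _ "\<lambda>e. v powr e"], simp)
    qed
    have "1 / v * type2_beta_density \<alpha>\<^sub>1 \<beta>\<^sub>1 (u / v) * type2_beta_density \<alpha>\<^sub>2 \<beta>\<^sub>2 v =
        1 / v * (?c1 * (u / v) powr \<alpha>\<^sub>1 * (1 + u / v) powr (- (\<alpha>\<^sub>1 + 1 + \<beta>\<^sub>1))) *
        (?c2 * v powr \<alpha>\<^sub>2 * (1 + v) powr (- (\<alpha>\<^sub>2 + 1 + \<beta>\<^sub>2)))"
      using v assms by (simp add: type2_beta_density_def)
    also have "\<dots> = ?c1 * ?c2 * u powr \<alpha>\<^sub>1 *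
        ((1 / v * v powr (- \<alpha>\<^sub>1) * v powr (\<alpha>\<^sub>1 + 1 + \<beta>\<^sub>1) * v powr \<alpha>\<^sub>2) *
          (u + v) powr (- (\<alpha>\<^sub>1 + 1 + \<beta>\<^sub>1)) * (1 + v) powr (- (\<alpha>\<^sub>2 + 1 + \<beta>\<^sub>2)))"
      unfolding A B by (simp only: mult_ac)
    finally show ?thesis unfolding C .
  qed
  have "mellin_convolution (type2_beta_density \<alpha>\<^sub>1 \<beta>\<^sub>1) (type2_beta_density \<alpha>\<^sub>2 \<beta>\<^sub>2) u =
      (LBINT v:{0<..}. ?c1 * ?c2 * u powr \<alpha>\<^sub>1 * ?I v)"
    unfolding mellin_convolution_def by (rule set_lebesgue_integral_cong) (simp, intro allI impI eq, simp)
  thus ?thesis by simp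
qed

lemma not_Ints_if_not_pm_nat:
  fixes x :: real
  assumes "\<forall>\<nu>::nat. x \<noteq> of_nat \<nu> \<and> x \<noteq> - of_nat \<nu>"
  shows "x \<notin> \<int>"
proof
  assume "x \<in> \<int>"
  then obtain n where "x = of_int n" by (auto elim: Ints_cases)
  thus False using assms by (cases n rule: int_cases2) auto
qed

theorem theorem2p2:
  fixes \<alpha>\<^sub>1 \<alpha>\<^sub>2 \<beta>\<^sub>1 \<beta>\<^sub>2 c :: real
    and f\<^sub>1 f\<^sub>2 g\<^sub>1 :: "real \<Rightarrow> real"
    and G :: "real \<Rightarrow> complex"
    and R\<^sub>0 R\<^sub>1 :: "real \<Rightarrow> real"
  assumes "\<alpha>\<^sub>1 > -1" and "\<alpha>\<^sub>2 > -1" and "\<beta>\<^sub>1 > 0" and "\<beta>\<^sub>2 > 0"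
    and "f\<^sub>1 = type2_beta_density \<alpha>\<^sub>1 \<beta>\<^sub>1"
    and "f\<^sub>2 = type2_beta_density \<alpha>\<^sub>2 \<beta>\<^sub>2"
    and "c = Gamma (\<alpha>\<^sub>1 + 1 + \<beta>\<^sub>1) / (Gamma (\<alpha>\<^sub>1 + 1) * Gamma \<beta>\<^sub>1) *
             (Gamma (\<alpha>\<^sub>2 + 1 + \<beta>\<^sub>2) / (Gamma (\<alpha>\<^sub>2 + 1) * Gamma \<beta>\<^sub>2))"
    and "g\<^sub>1 = mellin_convolution f\<^sub>1 f\<^sub>2"
    and "G = (\<lambda>u. meijer_G 2 2 [- of_real \<beta>\<^sub>1, - of_real \<beta>\<^sub>2] [of_real \<alpha>\<^sub>1, of_real \<alpha>\<^sub>2] (of_real u))"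
    and "R\<^sub>0 = (\<lambda>u.
           Gamma (\<alpha>\<^sub>2 - \<alpha>\<^sub>1) * Gamma (\<beta>\<^sub>1 + 1 + \<alpha>\<^sub>1) * Gamma (\<beta>\<^sub>2 + 1 + \<alpha>\<^sub>1) * u powr \<alpha>\<^sub>1 *
             hyp2F1 (\<beta>\<^sub>1 + 1 + \<alpha>\<^sub>1) (\<beta>\<^sub>2 + 1 + \<alpha>\<^sub>1) (1 + \<alpha>\<^sub>1 - \<alpha>\<^sub>2) u +
           Gamma (\<alpha>\<^sub>1 - \<alpha>\<^sub>2) * Gamma (\<beta>\<^sub>1 + 1 + \<alpha>\<^sub>2) * Gamma (\<beta>\<^sub>2 + 1 + \<alpha>\<^sub>2) * u powr \<alpha>\<^sub>2 *
             hyp2F1 (\<beta>\<^sub>1 + 1 + \<alpha>\<^sub>2) (\<beta>\<^sub>2 + 1 + \<alpha>\<^sub>2) (1 + \<alpha>\<^sub>2 - \<alpha>\<^sub>1) u)"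
    and "R\<^sub>1 = (\<lambda>u.
           Gamma (\<alpha>\<^sub>1 + 1 + \<beta>\<^sub>1) * Gamma (\<alpha>\<^sub>2 + \<beta>\<^sub>1 + 1) * Gamma (\<beta>\<^sub>2 - \<beta>\<^sub>1) * u powr (- \<beta>\<^sub>1 - 1) *
             hyp2F1 (\<alpha>\<^sub>1 + \<beta>\<^sub>1 + 1) (\<alpha>\<^sub>2 + \<beta>\<^sub>1 + 1) (1 + \<beta>\<^sub>1 - \<beta>\<^sub>2) (1 / u) +
           Gamma (\<alpha>\<^sub>1 + \<beta>\<^sub>2 + 1) * Gamma (\<alpha>\<^sub>2 + \<beta>\<^sub>2 + 1) * Gamma (\<beta>\<^sub>1 - \<beta>\<^sub>2) * u powr (- \<beta>\<^sub>2 - 1) *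
             hyp2F1 (\<alpha>\<^sub>1 + \<beta>\<^sub>2 + 1) (\<alpha>\<^sub>2 + \<beta>\<^sub>2 + 1) (1 + \<beta>\<^sub>2 - \<beta>\<^sub>1) (1 / u))"
  shows "(\<forall>u\<ge>0.
            g\<^sub>1 u = c * u powr \<alpha>\<^sub>1 *
              (LBINT v:{0<..}. v powr (\<beta>\<^sub>1 + \<alpha>\<^sub>2) * (u + v) powr (- (\<alpha>\<^sub>1 + 1 + \<beta>\<^sub>1)) *
                 (1 + v) powr (- (\<alpha>\<^sub>2 + 1 + \<beta>\<^sub>2))) \<and>
            g\<^sub>1 u = c * u powr \<alpha>\<^sub>2 *
              (LBINT v:{0<..}. v powr (\<alpha>\<^sub>1 + \<beta>\<^sub>2) * (1 + v) powr (- (\<alpha>\<^sub>1 + 1 + \<beta>\<^sub>1)) *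
                 (v + u) powr (- (\<alpha>\<^sub>2 + 1 + \<beta>\<^sub>2))) \<and>
            of_real (g\<^sub>1 u) =
              of_real (1 / (Gamma (\<alpha>\<^sub>1 + 1) * Gamma \<beta>\<^sub>1) * (1 / (Gamma (\<alpha>\<^sub>2 + 1) * Gamma \<beta>\<^sub>2))) * G u) \<and>
         ((\<forall>\<nu>::nat. \<alpha>\<^sub>1 - \<alpha>\<^sub>2 \<noteq> of_nat \<nu> \<and> \<alpha>\<^sub>1 - \<alpha>\<^sub>2 \<noteq> - of_nat \<nu>) \<longrightarrow>
            (\<forall>u. 0 \<le> u \<and> u < 1 \<longrightarrow> G u = of_real (R\<^sub>0 u))) \<and>
         ((\<forall>\<nu>::nat. \<beta>\<^sub>1 - \<beta>\<^sub>2 \<noteq> of_nat \<nu> \<and> \<beta>\<^sub>1 - \<beta>\<^sub>2 \<noteq> - of_nat \<nu>) \<longrightarrow>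
            (\<forall>u>1. G u = of_real (R\<^sub>1 u)) \<and>
            (hyp2F1_converges (\<alpha>\<^sub>1 + \<beta>\<^sub>1 + 1) (\<alpha>\<^sub>2 + \<beta>\<^sub>1 + 1) (1 + \<beta>\<^sub>1 - \<beta>\<^sub>2) 1 \<and>
             hyp2F1_converges (\<alpha>\<^sub>1 + \<beta>\<^sub>2 + 1) (\<alpha>\<^sub>2 + \<beta>\<^sub>2 + 1) (1 + \<beta>\<^sub>2 - \<beta>\<^sub>1) 1
               \<longrightarrow> G 1 = of_real (R\<^sub>1 1)) \<and>
            ((\<lambda>u. of_real (R\<^sub>1 u)) \<longlongrightarrow> G 1) (at_right 1))"
proof -
  note pos = assms(1-4)
  note f\<^sub>1 = assms(5) and f\<^sub>2 = assms(6) and c = assms(7) and g\<^sub>1 = assms(8)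
    and G = assms(9) and R\<^sub>0 = assms(10) and R\<^sub>1 = assms(11)
  let ?I = "\<lambda>u. LBINT v:{0<..}. v powr (\<beta>\<^sub>1 + \<alpha>\<^sub>2) * (u + v) powr (- (\<alpha>\<^sub>1 + 1 + \<beta>\<^sub>1)) *
                 (1 + v) powr (- (\<alpha>\<^sub>2 + 1 + \<beta>\<^sub>2))"
  let ?J = "\<lambda>u. LBINT v:{0<..}. v powr (\<alpha>\<^sub>1 + \<beta>\<^sub>2) * (1 + v) powr (- (\<alpha>\<^sub>1 + 1 + \<beta>\<^sub>1)) *
                 (v + u) powr (- (\<alpha>\<^sub>2 + 1 + \<beta>\<^sub>2))"
  let ?\<Gamma> = "Gamma (\<alpha>\<^sub>1 + 1 + \<beta>\<^sub>1) * Gamma (\<alpha>\<^sub>2 + 1 + \<beta>\<^sub>2)"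
  let ?k = "1 / (Gamma (\<alpha>\<^sub>1 + 1) * Gamma \<beta>\<^sub>1) * (1 / (Gamma (\<alpha>\<^sub>2 + 1) * Gamma \<beta>\<^sub>2))"
  have c_eq: "c = ?k * ?\<Gamma>" unfolding c by (simp add: field_simps)
  have G1: "G u = of_real (?\<Gamma> * (u powr \<alpha>\<^sub>1 * ?I u))" if "u \<ge> 0" for u
    unfolding G using meijer_G_eq_real_integral[OF pos that] .
  have G2: "G u = of_real (?\<Gamma> * (u powr \<alpha>\<^sub>2 * ?J u))" if "u \<ge> 0" for u
    unfolding G using meijer_G_eq_real_integral[OF pos(2,1,4,3) that]
    by (simp only: meijer_G_swap[of \<beta>\<^sub>2 \<beta>\<^sub>1 \<alpha>\<^sub>2 \<alpha>\<^sub>1]) (simp only: mult_ac add.commute)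
  have g1: "g\<^sub>1 u = c * u powr \<alpha>\<^sub>1 * ?I u" if "u \<ge> 0" for u
    unfolding g\<^sub>1 f\<^sub>1 f\<^sub>2 c by (rule mellin_convolution_type2_beta[OF that])
  have part1: "g\<^sub>1 u = c * u powr \<alpha>\<^sub>1 * ?I u \<and> g\<^sub>1 u = c * u powr \<alpha>\<^sub>2 * ?J u \<and>
      of_real (g\<^sub>1 u) = of_real ?k * G u" if "u \<ge> 0" for u
  proof -
    have "?\<Gamma> * (u powr \<alpha>\<^sub>1 * ?I u) = ?\<Gamma> * (u powr \<alpha>\<^sub>2 * ?J u)"
      using G1[OF that] G2[OF that] by (simp only: of_real_eq_iff)
    hence "?k * (?\<Gamma> * (u powr \<alpha>\<^sub>1 * ?I u)) = ?k * (?\<Gamma> * (u powr \<alpha>\<^sub>2 * ?J u))" by (rule arg_cong)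
    hence "g\<^sub>1 u = c * u powr \<alpha>\<^sub>2 * ?J u" unfolding g1[OF that] c_eq by (simp only: mult.assoc)
    moreover have "of_real (g\<^sub>1 u) = of_real ?k * G u"
      unfolding g1[OF that] c_eq G1[OF that] by (simp only: of_real_mult mult.assoc)
    ultimately show ?thesis using g1[OF that] by blast
  qed
  obtain \<kappa> where \<kappa>: "\<alpha>\<^sub>1 + \<kappa> > 0" "\<alpha>\<^sub>2 + \<kappa> > 0" "1 + \<beta>\<^sub>1 - \<kappa> > 0" "1 + \<beta>\<^sub>2 - \<kappa> > 0"
    and G_barnes: "\<And>u. u > 0 \<Longrightarrow> meijer_G 2 2 [- of_real \<beta>\<^sub>1, - of_real \<beta>\<^sub>2] [of_real \<alpha>\<^sub>1, of_real \<alpha>\<^sub>2] (of_real u) =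
       of_real (u powr (- \<kappa>) / (2 * pi)) *
       (LBINT t. barnes_integrand (\<alpha>\<^sub>1 + \<kappa>) (\<alpha>\<^sub>2 + \<kappa>) (1 + \<beta>\<^sub>1 - \<kappa>) (1 + \<beta>\<^sub>2 - \<kappa>) (\<i> * t) * exp (- (\<i> * of_real (ln u * t))))"
    using meijer_G_eq_barnes_integral[OF pos] by blast
  let ?F = "\<lambda>x. LBINT t. barnes_integrand (\<alpha>\<^sub>1 + \<kappa>) (\<alpha>\<^sub>2 + \<kappa>) (1 + \<beta>\<^sub>1 - \<kappa>) (1 + \<beta>\<^sub>2 - \<kappa>) (\<i> * t) * exp (- (\<i> * of_real (x * t)))"
  have G_eq: "G u = of_real (u powr (- \<kappa>) / (2 * pi)) * ?F (ln u)" if "u > 0" for u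
    unfolding G by (rule G_barnes[OF that])
  have part2: "G u = of_real (R\<^sub>0 u)"
    if noint: "\<alpha>\<^sub>1 - \<alpha>\<^sub>2 \<notin> \<int>" and u: "0 \<le> u" "u < 1" for u
  proof (cases "u = 0")
    case True
    thus ?thesis by (simp add: G R\<^sub>0 meijer_G_zero)
  next
    case False
    hence u0: "u > 0" using u by simp
    have noint': "(\<alpha>\<^sub>1 + \<kappa>) - (\<alpha>\<^sub>2 + \<kappa>) \<notin> \<int>" using noint by simp
    have e: "(a + \<kappa>) + (1 + b - \<kappa>) = b + 1 + a" "1 + (a + \<kappa>) - (a' + \<kappa>) = 1 + a - a'"
      "(a + \<kappa>) - (a' + \<kappa>) = a - a'" for a a' b by simp_all
    have p: "u powr (- \<kappa>) * u powr (a + \<kappa>) = u powr a" for a by (simp flip: powr_add)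
    let ?T = "\<lambda>a a' E. Gamma (a' - a) * Gamma (\<beta>\<^sub>1 + 1 + a) * Gamma (\<beta>\<^sub>2 + 1 + a) * E *
        hyp2F1 (\<beta>\<^sub>1 + 1 + a) (\<beta>\<^sub>2 + 1 + a) (1 + a - a') u"
    have "G u = of_real (u powr (- \<kappa>) / (2 * pi)) * (of_real (2 * pi) *
       of_real (?T \<alpha>\<^sub>1 \<alpha>\<^sub>2 (u powr (\<alpha>\<^sub>1 + \<kappa>)) + ?T \<alpha>\<^sub>2 \<alpha>\<^sub>1 (u powr (\<alpha>\<^sub>2 + \<kappa>))))"
      unfolding G_eq[OF u0] barnes_integral_eq_hypergeo[OF \<kappa> noint' u0 u(2)] e ..
    also have "\<dots> = of_real (?T \<alpha>\<^sub>1 \<alpha>\<^sub>2 (u powr (- \<kappa>) * u powr (\<alpha>\<^sub>1 + \<kappa>)) + ?T \<alpha>\<^sub>2 \<alpha>\<^sub>1 (u powr (- \<kappa>) * u powr (\<alpha>\<^sub>2 + \<kappa>)))"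
      unfolding of_real_mult[symmetric] by (rule arg_cong[of _ _ of_real]) (simp add: algebra_simps)
    finally show ?thesis unfolding p R\<^sub>0 .
  qed
  have part3: "G u = of_real (R\<^sub>1 u)"
    if noint: "\<beta>\<^sub>1 - \<beta>\<^sub>2 \<notin> \<int>" and u: "u > 1" for u
  proof -
    have u0: "u > 0" and iu: "0 < 1 / u" "1 / u < 1" using u by auto
    have noint': "(1 + \<beta>\<^sub>1 - \<kappa>) - (1 + \<beta>\<^sub>2 - \<kappa>) \<notin> \<int>" using noint by simp
    have e: "(1 + b - \<kappa>) + (a + \<kappa>) = a + b + 1" "1 + (1 + b - \<kappa>) - (1 + b' - \<kappa>) = 1 + b - b'"
      "(1 + b - \<kappa>) - (1 + b' - \<kappa>) = b - b'" for a b b' by simp_all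
    have p: "u powr (- \<kappa>) * (1 / u) powr (1 + b - \<kappa>) = u powr (- b - 1)" for b
    proof -
      have "(1 / u) powr (1 + b - \<kappa>) = u powr (- (1 + b - \<kappa>))"
        using u0 by (simp only: powr_minus_divide) (simp add: powr_divide)
      hence "u powr (- \<kappa>) * (1 / u) powr (1 + b - \<kappa>) = u powr (- \<kappa> + - (1 + b - \<kappa>))"
        by (simp only: powr_add)
      also have "- \<kappa> + - (1 + b - \<kappa>) = - b - 1" by simp
      finally show ?thesis .
    qed
    let ?T = "\<lambda>b b' E. Gamma (b' - b) * Gamma (\<alpha>\<^sub>1 + b + 1) * Gamma (\<alpha>\<^sub>2 + b + 1) * E *
        hyp2F1 (\<alpha>\<^sub>1 + b + 1) (\<alpha>\<^sub>2 + b + 1) (1 + b - b') (1 / u)"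
    have "- ln u = ln (1 / u)" using u0 by (simp add: ln_div)
    hence "?F (ln u) = of_real (2 * pi) * of_real (?T \<beta>\<^sub>1 \<beta>\<^sub>2 ((1 / u) powr (1 + \<beta>\<^sub>1 - \<kappa>)) + ?T \<beta>\<^sub>2 \<beta>\<^sub>1 ((1 / u) powr (1 + \<beta>\<^sub>2 - \<kappa>)))"
      using barnes_integral_eq_hypergeo[OF \<kappa>(3,4,1,2) noint' iu] unfolding e
      by (subst barnes_integral_reflect) (simp only:)
    hence "G u = of_real (u powr (- \<kappa>) / (2 * pi)) * (of_real (2 * pi) *
       of_real (?T \<beta>\<^sub>1 \<beta>\<^sub>2 ((1 / u) powr (1 + \<beta>\<^sub>1 - \<kappa>)) + ?T \<beta>\<^sub>2 \<beta>\<^sub>1 ((1 / u) powr (1 + \<beta>\<^sub>2 - \<kappa>))))"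
      unfolding G_eq[OF u0] by (rule arg_cong)
    also have "\<dots> = of_real (?T \<beta>\<^sub>1 \<beta>\<^sub>2 (u powr (- \<kappa>) * (1 / u) powr (1 + \<beta>\<^sub>1 - \<kappa>)) + ?T \<beta>\<^sub>2 \<beta>\<^sub>1 (u powr (- \<kappa>) * (1 / u) powr (1 + \<beta>\<^sub>2 - \<kappa>)))"
      unfolding of_real_mult[symmetric] by (rule arg_cong[of _ _ of_real]) (simp add: algebra_simps)
    also have "\<dots> = of_real (R\<^sub>1 u)" unfolding p R\<^sub>1 by (simp only: mult_ac add_ac)
    finally show ?thesis .
  qed
  have G_cont: "(G \<longlongrightarrow> G 1) (at_right 1)"
  proof -
    have "isCont ?F (ln 1)"
      unfolding isCont_def by (rule tendsto_fourier_integral[OF integrable_barnes_line[OF \<kappa>]])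
    moreover have "(ln \<longlongrightarrow> ln 1) (at_right (1::real))" by (intro tendsto_intros) auto
    ultimately have "((\<lambda>u. ?F (ln u)) \<longlongrightarrow> ?F (ln 1)) (at_right 1)" by (rule isCont_tendsto_compose)
    hence "((\<lambda>u. of_real (u powr (- \<kappa>) / (2 * pi)) * ?F (ln u)) \<longlongrightarrow> of_real (1 powr (- \<kappa>) / (2 * pi)) * ?F (ln 1)) (at_right 1)"
      by (intro tendsto_intros) auto
    moreover have "eventually (\<lambda>u::real. u > 0) (at_right 1)"
      using eventually_at_right_less[of "1::real"] by eventually_elim simp
    hence "eventually (\<lambda>u. of_real (u powr (- \<kappa>) / (2 * pi)) * ?F (ln u) = G u) (at_right 1)"
      by eventually_elim (simp only: G_eq)
    ultimately show ?thesis unfolding G_eq[OF zero_less_one] by (rule Lim_transform_eventually)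
  qed
  have part5: "((\<lambda>u. of_real (R\<^sub>1 u)) \<longlongrightarrow> G 1) (at_right 1)" if "\<beta>\<^sub>1 - \<beta>\<^sub>2 \<notin> \<int>"
  proof (rule Lim_transform_eventually[OF G_cont])
    show "eventually (\<lambda>u. G u = of_real (R\<^sub>1 u)) (at_right 1)"
      using eventually_at_right_less[of "1::real"] by eventually_elim (rule part3[OF that])
  qed
  have part4: "G 1 = of_real (R\<^sub>1 1)"
    if noint: "\<beta>\<^sub>1 - \<beta>\<^sub>2 \<notin> \<int>"
      and conv: "hyp2F1_converges (\<alpha>\<^sub>1 + \<beta>\<^sub>1 + 1) (\<alpha>\<^sub>2 + \<beta>\<^sub>1 + 1) (1 + \<beta>\<^sub>1 - \<beta>\<^sub>2) 1"
        "hyp2F1_converges (\<alpha>\<^sub>1 + \<beta>\<^sub>2 + 1) (\<alpha>\<^sub>2 + \<beta>\<^sub>2 + 1) (1 + \<beta>\<^sub>2 - \<beta>\<^sub>1) 1"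
  proof -
    have inv: "filterlim (\<lambda>u::real. 1 / u) (at_left 1) (at_right 1)"
      unfolding filterlim_at
    proof
      show "((\<lambda>u::real. 1 / u) \<longlongrightarrow> 1) (at_right 1)" by (auto intro!: tendsto_eq_intros)
      show "\<forall>\<^sub>F u::real in at_right 1. 1 / u \<in> {..<1} \<and> 1 / u \<noteq> 1"
        using eventually_at_right_less[of "1::real"] by eventually_elim auto
    qed
    have H: "((\<lambda>u. hyp2F1 A B C (1 / u)) \<longlongrightarrow> hyp2F1 A B C (1 / 1)) (at_right 1)"
      if "A > 0" "B > 0" "hyp2F1_converges A B C 1" for A B C
      using filterlim_compose[OF hyp2F1_tendsto_1[OF that] inv] by simp
    have "(R\<^sub>1 \<longlongrightarrow> R\<^sub>1 1) (at_right 1)"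
      unfolding R\<^sub>1 using pos conv by (intro tendsto_intros H) auto
    hence "((\<lambda>u. complex_of_real (R\<^sub>1 u)) \<longlongrightarrow> of_real (R\<^sub>1 1)) (at_right 1)" by (intro tendsto_intros)
    with part5[OF noint] show ?thesis by (intro tendsto_unique[of "at_right (1::real)"]) auto
  qed
  show ?thesis
    using part1 part2 part3 part4 part5 not_Ints_if_not_pm_nat by blast
qed

end
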